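(* Fix an integer $n\geq 1$, let $0<\rho\leq\infty$, and let $I=(0,\rho)$. Suppose that $f\in C^{2n-2}(I)$ is real-valued. Then the following assertions are equivalent. (i) For every $A\in\mathbb{P}_n(I)$, one has $f[A]\succeq 0$. (ii) For every $R\in\mathbb{P}_n^1(I)$, one has $f[R]\succeq 0$, and $f^{(k)}(x)\geq 0$ for all $x\in I$ and all integers $0\leq k\leq n-1$. (iii) $f^{(k)}(x)\geq 0$ for all $x\in I$ and all integers $0\leq k\leq n-1$, and $$\mathcal{H}_n(f;x)=\bigl[\mathcal{E}^{i+j}f(x)\bigr]_{i,j=0}^{n-1}\succeq 0\qquad\text{for all } x\in I.$$
   Context: For an interval $I\subset(0,\infty)$, $\mathbb{P}_n(I)$ denotes the set of real symmetric positive semidefinite $n\times n$ matrices all of whose entries lie in $I$, and $\mathbb{P}_n^1(I)$ denotes the set of matrices of rank $1$ in $\mathbb{P}_n(I)$. For $f:I\to\mathbb{R}$ and $A=[a_{ij}]$ with entries in $I$, $f[A]:=[f(a_{ij})]_{i,j=1}^n$ (entrywise application). $B\succeq 0$ means that $B$ is positive semidefinite. $\mathcal{E}:=x\frac{d}{dx}$ is the Euler derivative, i.e. $(\mathcal{E}f)(x)=xf'(x)$, and $\mathcal{E}^k$ is its $k$-fold iterate ($\mathcal{E}^0f=f$). $f^{(k)}$ is the ordinary $k$th derivative. *)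

theory Defs
  imports
    "HOL-Analysis.Derivative"
    "HOL-Library.Extended_Real"
    "Jordan_Normal_Form.DL_Rank"
begin

definition pos_semidef :: "nat \<Rightarrow> real mat \<Rightarrow> bool" where
  "pos_semidef n A \<longleftrightarrow> A \<in> carrier_mat n n \<and> transpose_mat A = A \<and>
     (\<forall>v \<in> carrier_vec n. 0 \<le> scalar_prod v (A *\<^sub>v v))"

definition psd_mats :: "nat \<Rightarrow> real set \<Rightarrow> real mat set" where
  "psd_mats n I = {A. pos_semidef n A \<and> elements_mat A \<subseteq> I}"

definition psd_mats_rank1 :: "nat \<Rightarrow> real set \<Rightarrow> real mat set" where
  "psd_mats_rank1 n I = {A \<in> psd_mats n I. vec_space.rank n A = 1}"

text \<open>Functions on an open set \<open>I\<close> are represented by total functions on the reals; since \<open>I\<close> is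
  open, neither \<^const>\<open>deriv\<close> nor differentiability at a point of \<open>I\<close> depends on the values
  outside \<open>I\<close>. Differentiability is required explicitly because \<^const>\<open>deriv\<close> is total.\<close>

definition C_k_on :: "nat \<Rightarrow> real set \<Rightarrow> (real \<Rightarrow> real) \<Rightarrow> bool" where
  "C_k_on k I f \<longleftrightarrow> (\<forall>j<k. \<forall>x\<in>I. (deriv ^^ j) f differentiable (at x)) \<and>
     continuous_on I ((deriv ^^ k) f)"

definition euler :: "(real \<Rightarrow> real) \<Rightarrow> real \<Rightarrow> real" where
  "euler f = (\<lambda>x. x * deriv f x)"

definition euler_hankel :: "nat \<Rightarrow> (real \<Rightarrow> real) \<Rightarrow> real \<Rightarrow> real mat" where
  "euler_hankel n f x = mat n n (\<lambda>(i, j). (euler ^^ (i + j)) f x)"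

end

theory Submission
  imports Defs "HOL-Analysis.Function_Topology"
begin

text \<open>
  Put \<open>g t = f (exp t)\<close>. Then the \<open>k\<close>th Euler derivative of \<open>f\<close> at \<open>exp t\<close> is the \<open>k\<close>th derivative
  of \<open>g\<close> at \<open>t\<close>, images of rank one matrices with positive entries become kernels \<open>g (t\<^sub>i + t\<^sub>j)\<close>, and
  the matrices in (iii) become Hankel matrices of derivatives of \<open>g\<close>.
  Finite differences pass from the kernels to the Hankel matrices. Conversely, if all Hankel matrices
  of \<open>g\<close> are positive definite, then \<open>g, g', g'', \<dots>\<close> is a Chebyshev system (divide by the first function,
  differentiate, and use Rolle's theorem), hence so are the translates of \<open>g\<close>, and the kernel
  \<open>g (t\<^sub>i + t\<^sub>j)\<close> is nonsingular; adding multiples of a sum of exponentials turns this into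
  semidefiniteness. For general matrices, the argument of FitzGerald and Horn subtracts from \<open>A\<close> a rank one
  matrix with the same last row and differentiates along the segment, which reduces the claim for \<open>f\<close> to
  that for \<open>f'\<close> in one dimension less. The derivative conditions for a preserver follow from Horn's
  argument: test \<open>f[a + e u u\<^sup>T]\<close> against difference coefficients and let \<open>e\<close> tend to \<open>0\<close>.
\<close>

section \<open>Functions of class \<open>C\<^sup>k\<close>\<close>

lemma deriv_cong_on:
  fixes f g :: "real \<Rightarrow> real"
  assumes "open S" "\<And>x. x \<in> S \<Longrightarrow> f x = g x" "x \<in> S"
  shows "deriv f x = deriv g x"
proof (rule deriv_cong_ev[OF _ refl])
  show "\<forall>\<^sub>F y in nhds x. f y = g y"
    using assms eventually_nhds by blast
qed

lemma funpow_deriv_cong_on: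
  fixes f g :: "real \<Rightarrow> real"
  assumes "open S" "\<And>x. x \<in> S \<Longrightarrow> f x = g x" "x \<in> S"
  shows "(deriv ^^ k) f x = (deriv ^^ k) g x"
  using assms(3)
proof (induction k arbitrary: x)
  case 0
  then show ?case using assms by simp
next
  case (Suc k)
  then show ?case using deriv_cong_on[OF assms(1) Suc.IH] by simp
qed

lemma differentiable_cong_on:
  fixes f g :: "real \<Rightarrow> real"
  assumes "open S" "\<And>x. x \<in> S \<Longrightarrow> f x = g x" "x \<in> S" "f differentiable (at x)"
  shows "g differentiable (at x)"
  using assms unfolding differentiable_def
  by (blast intro: has_derivative_transform_within_open)

lemma differentiable_imp_has_deriv:
  fixes f :: "real \<Rightarrow> real"
  assumes "f differentiable (at x)"
  shows "(f has_real_derivative deriv f x) (at x)"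
  using assms DERIV_deriv_iff_real_differentiable by blast

lemma C_k_on_0 [simp]: "C_k_on 0 S f \<longleftrightarrow> continuous_on S f"
  by (simp add: C_k_on_def)

text \<open>Splitting off the first derivative instead of the last one turns the closure properties
  below into inductions on \<open>k\<close> with \<open>f\<close> generalized.\<close>

lemma C_k_on_Suc:
  "C_k_on (Suc k) S f \<longleftrightarrow> (\<forall>x\<in>S. f differentiable (at x)) \<and> C_k_on k S (deriv f)"
proof -
  have "(deriv ^^ Suc j) f = (deriv ^^ j) (deriv f)" for j
    by (simp add: funpow_Suc_right del: funpow.simps)
  then show ?thesis
    unfolding C_k_on_def by (auto simp: All_less_Suc2 simp del: funpow.simps(2))
qed

text \<open>The differentiation rules describe \<open>deriv\<close> only at points of
  \<open>S\<close>. Since derivatives are local and \<open>S\<close> is open, this suffices to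
  replace the total function \<open>deriv f\<close> by a formula.\<close>

lemma C_k_on_cong:
  assumes "open S" "\<And>x. x \<in> S \<Longrightarrow> f x = g x"
  shows "C_k_on k S f \<longleftrightarrow> C_k_on k S g"
proof -
  have *: "C_k_on k S g" if "C_k_on k S f" "\<And>x. x \<in> S \<Longrightarrow> f x = g x" for f g
    using that
  proof (induction k arbitrary: f g)
    case 0
    then show ?case by (metis C_k_on_0 continuous_on_cong)
  next
    case (Suc k)
    then show ?case
      by (metis C_k_on_Suc assms(1) deriv_cong_on differentiable_cong_on)
  qed
  show ?thesis using *[of f g] *[of g f] assms(2) by auto
qed

lemma C_k_on_SucD: "C_k_on (Suc k) S f \<Longrightarrow> C_k_on k S f"
  by (induction k arbitrary: f) (auto simp: C_k_on_Suc intro!: continuous_at_imp_continuous_on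
      differentiable_imp_continuous_within)

lemma C_k_on_mono: "C_k_on k S f \<Longrightarrow> j \<le> k \<Longrightarrow> C_k_on j S f"
  by (rotate_tac 1, induction rule: inc_induct) (auto dest: C_k_on_SucD)

lemma C_k_on_subset: "C_k_on k S f \<Longrightarrow> T \<subseteq> S \<Longrightarrow> C_k_on k T f"
  unfolding C_k_on_def using continuous_on_subset by blast

lemma C_k_on_funpow_deriv: "C_k_on (j + k) S f \<Longrightarrow> C_k_on k S ((deriv ^^ j) f)"
proof (induction j arbitrary: f)
  case (Suc j)
  then show ?case
    by (simp add: funpow_Suc_right C_k_on_Suc del: funpow.simps)
qed simp

lemma C_k_on_has_deriv:
  assumes "C_k_on k S f" "j < k" "x \<in> S"
  shows "((deriv ^^ j) f has_real_derivative (deriv ^^ Suc j) f x) (at x)"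
  using assms differentiable_imp_has_deriv by (simp add: C_k_on_def)

lemma C_k_on_const [simp]: "C_k_on k S (\<lambda>x. c)"
proof (induction k arbitrary: c)
  case (Suc k)
  have "deriv (\<lambda>x. c) = (\<lambda>x. 0)" by (rule ext) simp
  then show ?case using Suc by (simp add: C_k_on_Suc)
qed simp

lemma C_k_on_add:
  assumes "open S" "C_k_on k S f" "C_k_on k S g"
  shows "C_k_on k S (\<lambda>x. f x + g x)"
  using assms(2,3)
proof (induction k arbitrary: f g)
  case 0
  then show ?case by (simp add: continuous_on_add)
next
  case (Suc k)
  have "deriv (\<lambda>x. f x + g x) x = deriv f x + deriv g x" if "x \<in> S" for x
    by (intro DERIV_imp_deriv derivative_intros differentiable_imp_has_deriv)
      (use Suc.prems that C_k_on_Suc in blast)+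
  then have "C_k_on k S (deriv (\<lambda>x. f x + g x)) = C_k_on k S (\<lambda>x. deriv f x + deriv g x)"
    by (intro C_k_on_cong[OF assms(1)])
  then show ?case using Suc by (auto simp: C_k_on_Suc)
qed

lemma C_k_on_mult:
  assumes "open S" "C_k_on k S f" "C_k_on k S g"
  shows "C_k_on k S (\<lambda>x. f x * g x)"
  using assms(2,3)
proof (induction k arbitrary: f g)
  case 0
  then show ?case by (simp add: continuous_on_mult)
next
  case (Suc k)
  have "deriv (\<lambda>x. f x * g x) x = deriv f x * g x + f x * deriv g x" if "x \<in> S" for x
    by (rule DERIV_imp_deriv, rule DERIV_mult'[THEN DERIV_cong, OF differentiable_imp_has_deriv differentiable_imp_has_deriv])
      (use Suc.prems that C_k_on_Suc in auto)
  then have *: "C_k_on k S (deriv (\<lambda>x. f x * g x)) = C_k_on k S (\<lambda>x. deriv f x * g x + f x * deriv g x)"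
    by (intro C_k_on_cong[OF assms(1)])
  have "C_k_on k S f" "C_k_on k S g" using Suc.prems C_k_on_SucD by auto
  then show ?case using Suc * by (auto simp: C_k_on_Suc intro!: C_k_on_add assms(1))
qed

lemma C_k_on_cmult: "open S \<Longrightarrow> C_k_on k S f \<Longrightarrow> C_k_on k S (\<lambda>x. c * f x)"
  by (rule C_k_on_mult) auto

lemma C_k_on_sum:
  assumes "open S" "\<And>i. i \<in> A \<Longrightarrow> C_k_on k S (f i)"
  shows "C_k_on k S (\<lambda>x. \<Sum>i\<in>A. f i x)"
  using assms(2)
  by (induction A rule: infinite_finite_induct) (auto intro!: C_k_on_add assms(1))

text \<open>The derivative of \<open>1/f\<close> is, up to sign, the product of
  \<open>deriv f\<close> and two copies of \<open>1/f\<close>, and the induction hypothesis covers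
  \<open>1/f\<close> itself.\<close>

lemma C_k_on_inverse:
  assumes "open S" "C_k_on k S f" "\<And>x. x \<in> S \<Longrightarrow> f x \<noteq> 0"
  shows "C_k_on k S (\<lambda>x. inverse (f x))"
  using assms(2)
proof (induction k)
  case 0
  then show ?case using assms(3) by (simp add: continuous_on_inverse)
next
  case (Suc k)
  have "deriv (\<lambda>x. inverse (f x)) x = (-1) * (inverse (f x) * deriv f x * inverse (f x))" if "x \<in> S" for x
    by (rule DERIV_imp_deriv, rule DERIV_inverse'[THEN DERIV_cong, OF differentiable_imp_has_deriv])
      (use Suc.prems that C_k_on_Suc assms(3) in auto)
  then have *: "C_k_on k S (deriv (\<lambda>x. inverse (f x))) = C_k_on k S (\<lambda>x. (-1) * (inverse (f x) * deriv f x * inverse (f x)))"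
    by (intro C_k_on_cong[OF assms(1)])
  have "C_k_on k S f" using Suc.prems C_k_on_SucD by auto
  then have "C_k_on k S (\<lambda>x. (-1) * (inverse (f x) * deriv f x * inverse (f x)))"
    using Suc by (intro C_k_on_cmult C_k_on_mult assms(1)) (auto simp: C_k_on_Suc)
  with * show ?case using Suc.prems assms(3)
    by (auto simp: C_k_on_Suc intro!: differentiable_inverse)
qed

lemma C_k_on_compose:
  assumes "open S" "open T" "C_k_on k S f" "C_k_on k T h" "h ` T \<subseteq> S"
  shows "C_k_on k T (\<lambda>x. f (h x))"
  using assms(3,4)
proof (induction k arbitrary: f)
  case 0
  then show ?case using assms(5) by (auto intro: continuous_on_compose2)
next
  case (Suc k)
  have d: "((\<lambda>x. f (h x)) has_real_derivative deriv f (h x) * deriv h x) (at x)" if "x \<in> T" for x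
    by (rule DERIV_chain2; rule differentiable_imp_has_deriv)
      (use Suc.prems that C_k_on_Suc assms(5) in auto)
  have *: "C_k_on k T (deriv (\<lambda>x. f (h x))) = C_k_on k T (\<lambda>x. deriv f (h x) * deriv h x)"
    by (rule C_k_on_cong[OF assms(2)]) (use d DERIV_imp_deriv in blast)
  have "C_k_on k T h" using Suc.prems C_k_on_SucD by auto
  then have "C_k_on k T (\<lambda>x. deriv f (h x) * deriv h x)"
    using Suc by (intro C_k_on_mult assms(2)) (auto simp: C_k_on_Suc)
  with * show ?case using d real_differentiable_def by (auto simp: C_k_on_Suc)
qed

lemma C_k_on_id: "C_k_on k S (\<lambda>x. x)"
  by (cases k) (auto simp: C_k_on_Suc)

lemma C_k_on_exp: "C_k_on k S exp"
proof -
  have "deriv exp = (exp :: real \<Rightarrow> real)"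
    by (rule ext) (rule DERIV_imp_deriv[OF DERIV_exp])
  then show ?thesis
    by (induction k) (auto simp: C_k_on_Suc continuous_on_exp intro: DERIV_exp simp: real_differentiable_def)
qed

lemma funpow_deriv_add:
  assumes "open S" "C_k_on k S f" "C_k_on k S g" "x \<in> S" "j \<le> k"
  shows "(deriv ^^ j) (\<lambda>x. f x + g x) x = (deriv ^^ j) f x + (deriv ^^ j) g x"
  using assms(4,5)
proof (induction j arbitrary: x)
  case (Suc j)
  have "(deriv ^^ Suc j) (\<lambda>x. f x + g x) x = deriv (\<lambda>x. (deriv ^^ j) f x + (deriv ^^ j) g x) x"
    using Suc by (auto intro!: deriv_cong_on[OF assms(1)])
  also have "\<dots> = (deriv ^^ Suc j) f x + (deriv ^^ Suc j) g x"
    by (intro DERIV_imp_deriv derivative_intros C_k_on_has_deriv[of k S]) (use assms Suc in auto)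
  finally show ?case .
qed simp

lemma funpow_deriv_cmult:
  assumes "open S" "C_k_on k S f" "x \<in> S" "j \<le> k"
  shows "(deriv ^^ j) (\<lambda>x. c * f x) x = c * (deriv ^^ j) f x"
  using assms(3,4)
proof (induction j arbitrary: x)
  case (Suc j)
  have "(deriv ^^ Suc j) (\<lambda>x. c * f x) x = deriv (\<lambda>x. c * (deriv ^^ j) f x) x"
    using Suc by (auto intro!: deriv_cong_on[OF assms(1)])
  also have "\<dots> = c * (deriv ^^ Suc j) f x"
    by (intro DERIV_imp_deriv DERIV_cmult C_k_on_has_deriv[of k S]) (use assms Suc in auto)
  finally show ?case .
qed simp

lemma funpow_deriv_const: "(deriv ^^ k) (\<lambda>x::real. c::real) = (\<lambda>x. if k = 0 then c else 0)"
proof (induction k)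
  case (Suc k)
  have "deriv (\<lambda>x::real. a::real) = (\<lambda>x. 0)" for a by (rule ext) simp
  then show ?case using Suc by simp
qed simp

lemma funpow_deriv_sum:
  assumes "open S" "finite A" "\<And>i. i \<in> A \<Longrightarrow> C_k_on k S (f i)" "x \<in> S" "j \<le> k"
  shows "(deriv ^^ j) (\<lambda>x. \<Sum>i\<in>A. f i x) x = (\<Sum>i\<in>A. (deriv ^^ j) (f i) x)"
  using assms(2,3)
proof (induction A)
  case (insert a A)
  then show ?case
    using funpow_deriv_add[OF assms(1) _ _ assms(4,5), of "f a" "\<lambda>x. \<Sum>i\<in>A. f i x"]
      C_k_on_sum[OF assms(1), of A k f] by auto
qed (simp add: funpow_deriv_const)

lemma funpow_deriv_shift:
  "(deriv ^^ j) (\<lambda>x::real. f (x + c) :: real) = (\<lambda>x. (deriv ^^ j) f (x + c))"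
proof (induction j)
  case (Suc j)
  have "deriv (\<lambda>x. h (x + c)) = (\<lambda>x. deriv h (x + c))" for h :: "real \<Rightarrow> real"
    unfolding deriv_def using DERIV_shift[of h _ _ c] by (simp add: fun_eq_iff)
  then show ?case using Suc by simp
qed simp

section \<open>Chebyshev systems and translation kernels\<close>

text \<open>Rolle's theorem between neighbouring zeros. The clause \<open>z < Max Z\<close> keeps
  the zeros found for the smaller set apart from the one found in the last gap.\<close>

lemma deriv_zeros_between:
  fixes h :: "real \<Rightarrow> real"
  assumes "is_interval J" "\<And>x. x \<in> J \<Longrightarrow> h differentiable (at x)"
    and "finite Z" "card Z = Suc m" "Z \<subseteq> J" "\<And>z. z \<in> Z \<Longrightarrow> h z = 0"
  shows "\<exists>Z'. finite Z' \<and> card Z' = m \<and> Z' \<subseteq> J \<and> (\<forall>z\<in>Z'. deriv h z = 0 \<and> z < Max Z)"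
  using assms(3-)
proof (induction m arbitrary: Z)
  case 0
  then show ?case by (intro exI[of _ "{}"]) auto
next
  case (Suc m)
  define b where "b = Max Z"
  define Y where "Y = Z - {b}"
  have b: "b \<in> Z" using Suc.prems b_def by (metis Max_in card.empty nat.distinct(1))
  have Y: "finite Y" "card Y = Suc m" "Y \<subseteq> J" "\<And>z. z \<in> Y \<Longrightarrow> h z = 0"
    using Suc.prems b by (auto simp: Y_def)
  obtain Y' where Y': "finite Y'" "card Y' = m" "Y' \<subseteq> J" "\<forall>z\<in>Y'. deriv h z = 0 \<and> z < Max Y"
    using Suc.IH[OF Y] by blast
  define a where "a = Max Y"
  have a: "a \<in> Y" using Y a_def by (metis Max_in card.empty nat.distinct(1))
  have ab: "a < b" using a Suc.prems b_def Y_def by (metis DiffD1 DiffD2 Max_ge insertI1 order_less_le)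
  have J: "{a..b} \<subseteq> J"
    using assms(1) a b Y(3) Suc.prems(3) by (auto simp: is_interval_1 subset_iff)
  have "\<exists>z>a. z < b \<and> deriv h z = 0"
  proof -
    have "continuous_on {a..b} h"
      using J assms(2) by (intro continuous_at_imp_continuous_on)
        (auto intro: differentiable_imp_continuous_within)
    moreover have "\<And>x. a < x \<Longrightarrow> x < b \<Longrightarrow> (h has_derivative (*) (deriv h x)) (at x)"
    proof -
      fix x assume "a < x" "x < b"
      then have "x \<in> J" using J by auto
      from differentiable_imp_has_deriv[OF assms(2)[OF this]]
      show "(h has_derivative (*) (deriv h x)) (at x)" by (simp add: has_field_derivative_def)
    qed
    ultimately obtain z where "a < z" "z < b" "(*) (deriv h z) = (\<lambda>v. 0)"
      using Rolle_deriv[OF ab, of h "\<lambda>x. (*) (deriv h x)"] Suc.prems(4)[OF b] Y(4)[OF a] by metis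
    then show ?thesis by (metis mult.comm_neutral)
  qed
  then obtain z where z: "a < z" "z < b" "deriv h z = 0" by blast
  have "z \<notin> Y'" using Y'(4) z a_def by force
  then show ?case
    using Y' z J ab a_def b_def by (intro exI[of _ "insert z Y'"]) force
qed

text \<open>By Leibniz, every term of the derivative contains a derivative of \<open>g\<close> of
  order at most \<open>i\<close>.\<close>

lemma funpow_deriv_mult_eq_0:
  assumes "open S" "x \<in> S" "C_k_on k S f" "C_k_on k S g" "\<And>i. i \<le> k \<Longrightarrow> (deriv ^^ i) g x = 0" "i \<le> k"
  shows "(deriv ^^ i) (\<lambda>y. f y * g y) x = 0"
  using assms(3-)
proof (induction k arbitrary: f g i)
  case 0
  then show ?case by simp
next
  case (Suc k)
  show ?case
  proof (cases i)
    case 0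
    then show ?thesis using Suc.prems(3)[of 0] by simp
  next
    case (Suc j)
    have C: "C_k_on k S f" "C_k_on k S g" "C_k_on k S (deriv f)" "C_k_on k S (deriv g)"
      using Suc.prems C_k_on_SucD by (auto simp: C_k_on_Suc)
    have d: "deriv (\<lambda>x. f x * g x) x = deriv f x * g x + f x * deriv g x" if "x \<in> S" for x
      by (rule DERIV_imp_deriv, rule DERIV_mult'[THEN DERIV_cong, OF differentiable_imp_has_deriv differentiable_imp_has_deriv])
        (use Suc.prems that C_k_on_Suc in auto)
    have g': "(deriv ^^ l) (deriv g) x = 0" if "l \<le> k" for l
      using Suc.prems(3)[of "Suc l"] that by (simp add: funpow_Suc_right del: funpow.simps)
    have "(deriv ^^ i) (\<lambda>y. f y * g y) x = (deriv ^^ j) (deriv (\<lambda>y. f y * g y)) x"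
      using Suc by (simp add: funpow_Suc_right del: funpow.simps)
    also have "\<dots> = (deriv ^^ j) (\<lambda>y. deriv f y * g y + f y * deriv g y) x"
      using d by (intro funpow_deriv_cong_on[OF assms(1) _ assms(2)])
    also have "\<dots> = (deriv ^^ j) (\<lambda>y. deriv f y * g y) x + (deriv ^^ j) (\<lambda>y. f y * deriv g y) x"
      by (rule funpow_deriv_add[OF assms(1) _ _ assms(2), of k])
        (use C Suc Suc.prems in \<open>auto intro!: C_k_on_mult assms\<close>)
    also have "\<dots> = 0"
      using Suc.IH[OF C(3) C(2), of j] Suc.IH[OF C(1) C(4), of j] Suc Suc.prems g' by auto
    finally show ?thesis .
  qed
qed

text \<open>The second hypothesis on \<open>u\<close> says that the Wronskians of
  \<open>u 0, ..., u (k - 1)\<close> vanish nowhere on \<open>J\<close>. Dividing by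
  \<open>u 0\<close> and differentiating removes one function and, by Rolle, one zero; the resulting
  functions \<open>v j\<close> satisfy the same hypotheses, so induction on \<open>m\<close>
  applies.\<close>

lemma chebyshev_system_zeros:
  fixes u :: "nat \<Rightarrow> real \<Rightarrow> real"
  assumes J: "open J" "is_interval J"
    and "\<And>j. j < m \<Longrightarrow> C_k_on (m - 1) J (u j)"
    and "\<And>k x a j. k \<le> m \<Longrightarrow> x \<in> J \<Longrightarrow> (\<And>i. i < k \<Longrightarrow> (\<Sum>j<k. a j * (deriv ^^ i) (u j) x) = 0) \<Longrightarrow> j < k \<Longrightarrow> a j = 0"
    and "Z \<subseteq> J" "finite Z" "card Z = m" "\<And>z. z \<in> Z \<Longrightarrow> (\<Sum>j<m. a j * u j z) = 0"
    and "j < m"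
  shows "a j = 0"
  using assms(3-)
proof (induction m arbitrary: u a Z j)
  case 0
  then show ?case by simp
next
  case (Suc m)
  note smooth = Suc.prems(1) and W = Suc.prems(2)
  have u0: "u 0 x \<noteq> 0" if "x \<in> J" for x
    using W[of 1 x "\<lambda>_. 1" 0] that by auto
  define q where "q = (\<lambda>j x. u (Suc j) x * inverse (u 0 x))"
  define v where "v = (\<lambda>j. deriv (q j))"
  have qC: "C_k_on m J (q j)" if "j < m" for j
    unfolding q_def by (intro C_k_on_mult C_k_on_inverse J)
      (use smooth[of 0] smooth[of "Suc j"] that u0 in auto)
  have vC: "C_k_on (m - 1) J (v j)" if "j < m" for j
    using qC[OF that] that by (cases m) (auto simp: v_def C_k_on_Suc)
  have vW: "a j = 0" if k: "k \<le> m" and x: "x \<in> J"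
      and a: "\<And>i. i < k \<Longrightarrow> (\<Sum>j<k. a j * (deriv ^^ i) (v j) x) = 0" and j: "j < k" for k x a j
  proof -
    define h where "h = (\<lambda>y. \<Sum>j<k. a j * q j y)"
    \<comment> \<open>\<open>H\<close> subtracts from \<open>h\<close> its value at
      \<open>x\<close>, so its jet up to order \<open>k\<close> vanishes there. Then so does that of
      \<open>u 0 * H\<close>, a combination of the \<open>Suc k\<close> functions \<open>u j\<close>
      with coefficients \<open>b\<close>, and the Wronskian hypothesis for \<open>u\<close> forces
      \<open>b\<close>, hence \<open>a\<close>, to vanish.\<close>
    define H where "H = (\<lambda>y. h y + (- h x))"
    define b where "b = case_nat (- h x) a"
    have hC: "C_k_on m J h" unfolding h_def
      by (intro C_k_on_sum C_k_on_cmult J qC) (use k in auto)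
    have HC: "C_k_on m J H" unfolding H_def by (intro C_k_on_add hC J) auto
    have H0: "(deriv ^^ i) H x = 0" if "i \<le> k" for i
    proof (cases i)
      case 0
      then show ?thesis by (simp add: H_def)
    next
      case (Suc l)
      have "(deriv ^^ i) H x = (deriv ^^ i) h x + (deriv ^^ i) (\<lambda>_. - h x) x"
        unfolding H_def by (rule funpow_deriv_add[OF J(1) hC _ x]) (use k that in auto)
      also have "\<dots> = (deriv ^^ i) h x" using Suc by (simp only: funpow_deriv_const) simp
      also have "\<dots> = (\<Sum>j<k. (deriv ^^ i) (\<lambda>y. a j * q j y) x)"
        unfolding h_def by (rule funpow_deriv_sum[OF J(1) _ _ x, of _ m])
          (use k that in \<open>auto intro!: C_k_on_cmult J qC\<close>)
      also have "\<dots> = (\<Sum>j<k. a j * (deriv ^^ i) (q j) x)"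
        using k that by (intro sum.cong refl funpow_deriv_cmult[OF J(1) qC x]) auto
      also have "\<dots> = (\<Sum>j<k. a j * (deriv ^^ l) (v j) x)"
        using Suc by (simp add: v_def funpow_Suc_right del: funpow.simps)
      finally show ?thesis using a[of l] that Suc by simp
    qed
    have bu: "u 0 y * H y = (\<Sum>j<Suc k. b j * u j y)" if "y \<in> J" for y
    proof -
      have "(\<Sum>j<Suc k. b j * u j y) = - h x * u 0 y + (\<Sum>j<k. a j * u (Suc j) y)"
        by (simp add: sum.lessThan_Suc_shift b_def del: sum.lessThan_Suc)
      also have "(\<Sum>j<k. a j * u (Suc j) y) = u 0 y * h y"
        using u0[OF that] by (simp add: h_def q_def sum_distrib_left field_simps)
      finally show ?thesis by (simp add: H_def algebra_simps)
    qed
    have "(\<Sum>j<Suc k. b j * (deriv ^^ i) (u j) x) = 0" if "i < Suc k" for i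
    proof -
      have uC: "C_k_on m J (u j)" if "j < Suc k" for j using smooth[of j] that k by auto
      have "(\<Sum>j<Suc k. b j * (deriv ^^ i) (u j) x) = (\<Sum>j<Suc k. (deriv ^^ i) (\<lambda>y. b j * u j y) x)"
        using k that by (intro sum.cong refl funpow_deriv_cmult[OF J(1) uC x, symmetric]) auto
      also have "\<dots> = (deriv ^^ i) (\<lambda>y. \<Sum>j<Suc k. b j * u j y) x"
        by (rule funpow_deriv_sum[OF J(1) _ _ x, symmetric, of _ m])
          (use k that in \<open>auto intro!: C_k_on_cmult J uC simp del: sum.lessThan_Suc\<close>)
      also have "\<dots> = (deriv ^^ i) (\<lambda>y. u 0 y * H y) x"
        by (rule funpow_deriv_cong_on[OF J(1) _ x]) (use bu in auto)
      also have "\<dots> = 0"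
        by (rule funpow_deriv_mult_eq_0[OF J(1) x, of k])
          (use uC[of 0] HC k H0 that C_k_on_mono in auto)
      finally show ?thesis .
    qed
    then have "b (Suc j) = 0" using W[of "Suc k" x b "Suc j"] k x j by auto
    then show ?thesis by (simp add: b_def)
  qed
  \<comment> \<open>The given combination divided by \<open>u 0\<close>: its zeros are the same, and
    the coefficient \<open>a 0\<close> is lost on differentiation.\<close>
  define h where "h = (\<lambda>y. (\<Sum>j<m. a (Suc j) * q j y) + a 0)"
  have sh: "(\<Sum>j<Suc m. a j * u j y) = a 0 * u 0 y + (\<Sum>j<m. a (Suc j) * u (Suc j) y)" for y
    by (simp add: sum.lessThan_Suc_shift del: sum.lessThan_Suc)
  have hZ: "h z = 0" if "z \<in> Z" for z
  proof -
    have "z \<in> J" using that Suc.prems by auto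
    have "u 0 z * h z = (\<Sum>j<Suc m. a j * u j z)"
      unfolding sh using u0[OF \<open>z \<in> J\<close>] by (simp add: h_def q_def sum_distrib_left field_simps)
    then show ?thesis using Suc.prems(6)[OF that] u0[OF \<open>z \<in> J\<close>] by simp
  qed
  have qd: "(q j has_real_derivative v j x) (at x)" if "j < m" "x \<in> J" for j x
    using C_k_on_has_deriv[OF qC[OF that(1)], of 0 x] that by (simp add: v_def)
  have hd: "(h has_real_derivative (\<Sum>j<m. a (Suc j) * v j x)) (at x)" if "x \<in> J" for x
    unfolding h_def using qd that by (auto intro!: derivative_eq_intros sum.cong)
  obtain Z' where Z': "finite Z'" "card Z' = m" "Z' \<subseteq> J" "\<forall>z\<in>Z'. deriv h z = 0"
  proof -
    have "h differentiable (at x)" if "x \<in> J" for x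
      using hd[OF that] by (auto simp: real_differentiable_def)
    then show ?thesis
      using deriv_zeros_between[OF J(2), of h Z m] Suc.prems(3-5) hZ that by blast
  qed
  have a0: "a (Suc j) = 0" if "j < m" for j
  proof (rule Suc.IH[of v Z' "\<lambda>j. a (Suc j)" j])
    show "(\<Sum>j<m. a (Suc j) * v j z) = 0" if "z \<in> Z'" for z
      using hd[of z] that Z' DERIV_imp_deriv by force
  qed (use vC vW Z' that in auto)
  \<comment> \<open>With the other coefficients gone, \<open>h\<close> is the constant
    \<open>a 0\<close>, and a single zero finishes the proof.\<close>
  have "Z \<noteq> {}" using Suc.prems by auto
  then obtain z where z: "z \<in> Z" by blast
  then have "h z = a 0" by (simp add: h_def a0)
  then have "a 0 = 0" using hZ z by simp
  then show ?case using a0 Suc.prems(7) by (cases j) auto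
qed

text \<open>A square matrix and its transpose have the same determinant. This will swap the roles of
  points and derivative orders.\<close>

lemma left_kernel_trivial:
  fixes M :: "nat \<Rightarrow> nat \<Rightarrow> real"
  assumes "\<And>a j. (\<And>i. i < k \<Longrightarrow> (\<Sum>j<k. a j * M i j) = 0) \<Longrightarrow> j < k \<Longrightarrow> a j = 0"
    and "\<And>j. j < k \<Longrightarrow> (\<Sum>i<k. c i * M i j) = 0" and "i < k"
  shows "c i = 0"
proof -
  define A where "A = mat k k (\<lambda>(i, j). M i j)"
  have A: "A \<in> carrier_mat k k" by (simp add: A_def)
  have "det A \<noteq> 0"
  proof
    assume "det A = 0"
    then obtain v where v: "v \<in> carrier_vec k" "v \<noteq> 0\<^sub>v k" "A *\<^sub>v v = 0\<^sub>v k"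
      using det_0_iff_vec_prod_zero[OF A] by blast
    have "(\<Sum>j<k. v $ j * M i j) = 0" if "i < k" for i
    proof -
      have "(A *\<^sub>v v) $ i = (\<Sum>j<k. v $ j * M i j)"
        using v(1) that by (simp add: A_def scalar_prod_def atLeast0LessThan mult.commute)
      then show ?thesis using v(3) that by simp
    qed
    then have "\<And>j. j < k \<Longrightarrow> v $ j = 0" using assms(1) by blast
    then have "v = 0\<^sub>v k" using v by auto
    then show False using v by simp
  qed
  then have d: "det (transpose_mat A) \<noteq> 0" using det_transpose[OF A] by simp
  have "transpose_mat A *\<^sub>v vec k c = 0\<^sub>v k"
    using assms(2) by (intro eq_vecI) (auto simp: A_def scalar_prod_def atLeast0LessThan mult.commute)
  then have "vec k c = 0\<^sub>v k"
    using d det_0_iff_vec_prod_zero[OF transpose_carrier_mat[THEN iffD2, OF A]] vec_carrier by blast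
  then show ?thesis using assms(3) by (metis index_vec index_zero_vec(1))
qed

section \<open>Quadratic forms and nonsingularity of translation kernels\<close>

definition quad_form :: "'a set \<Rightarrow> ('a \<Rightarrow> 'a \<Rightarrow> real) \<Rightarrow> ('a \<Rightarrow> real) \<Rightarrow> real" where
  "quad_form S M v = (\<Sum>s\<in>S. \<Sum>t\<in>S. v s * v t * M s t)"

text \<open>Matrices and vectors are total functions of which only the values on \<open>S\<close>
  count, so that one notion covers matrices indexed by numbers and kernels indexed by real
  points.\<close>

definition psd_on :: "'a set \<Rightarrow> ('a \<Rightarrow> 'a \<Rightarrow> real) \<Rightarrow> bool" where
  "psd_on S M \<longleftrightarrow> (\<forall>s\<in>S. \<forall>t\<in>S. M s t = M t s) \<and> (\<forall>v. 0 \<le> quad_form S M v)"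

definition pd_on :: "'a set \<Rightarrow> ('a \<Rightarrow> 'a \<Rightarrow> real) \<Rightarrow> bool" where
  "pd_on S M \<longleftrightarrow> (\<forall>s\<in>S. \<forall>t\<in>S. M s t = M t s) \<and> (\<forall>v. (\<exists>s\<in>S. v s \<noteq> 0) \<longrightarrow> 0 < quad_form S M v)"

lemma quad_form_add: "quad_form S (\<lambda>s t. M s t + N s t) v = quad_form S M v + quad_form S N v"
  by (simp add: quad_form_def distrib_left sum.distrib)

lemma quad_form_cmult: "quad_form S (\<lambda>s t. c * M s t) v = c * quad_form S M v"
  by (simp add: quad_form_def sum_distrib_left mult_ac)

lemma quad_form_scale: "quad_form S M (\<lambda>s. c * v s) = c\<^sup>2 * quad_form S M v"
  by (simp add: quad_form_def sum_distrib_left mult_ac power2_eq_square)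

lemma quad_form_cong:
  "(\<And>s t. s \<in> S \<Longrightarrow> t \<in> S \<Longrightarrow> M s t = N s t) \<Longrightarrow> (\<And>s. s \<in> S \<Longrightarrow> v s = w s) \<Longrightarrow> quad_form S M v = quad_form S N w"
  by (simp add: quad_form_def)

lemma quad_form_row: "quad_form S M v = (\<Sum>t\<in>S. v t * (\<Sum>s\<in>S. v s * M s t))"
  unfolding quad_form_def by (subst sum.swap) (simp add: sum_distrib_left mult_ac)

lemma quad_form_subset:
  assumes "finite S" "T \<subseteq> S" "\<And>s. s \<in> S - T \<Longrightarrow> v s = 0"
  shows "quad_form T M v = quad_form S M v"
proof -
  have "(\<Sum>t\<in>T. v s * v t * M s t) = (\<Sum>t\<in>S. v s * v t * M s t)" for s
    by (rule sum.mono_neutral_left) (use assms in auto)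
  moreover have "(\<Sum>s\<in>T. \<Sum>t\<in>S. v s * v t * M s t) = (\<Sum>s\<in>S. \<Sum>t\<in>S. v s * v t * M s t)"
    by (rule sum.mono_neutral_left) (use assms in auto)
  ultimately show ?thesis by (simp add: quad_form_def)
qed

text \<open>The Chebyshev lemma is used twice. For \<open>g, g', g'', ...\<close> the Wronskian
  matrices are leading blocks of the positive definite Hankel matrices. For the translates
  \<open>g (t + e i)\<close> they are, up to transposition, the matrices found nonsingular by the
  first use. The zeros are then the points of \<open>T\<close> itself.\<close>

lemma gram_nonsingular:
  assumes J: "open J" "is_interval J" and g: "C_k_on (2 * n - 2) J g"
    and pd: "\<And>x. x \<in> J \<Longrightarrow> pd_on {..<n} (\<lambda>i j. (deriv ^^ (i + j)) g x)"
    and T: "finite T" "card T \<le> n" "\<And>s t. s \<in> T \<Longrightarrow> t \<in> T \<Longrightarrow> s + t \<in> J"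
    and c: "\<And>t. t \<in> T \<Longrightarrow> (\<Sum>s\<in>T. c s * g (s + t)) = 0" and s: "s \<in> T"
  shows "c s = 0"
proof -
  define m where "m = card T"
  obtain e where e: "bij_betw e {..<m} T"
    using ex_bij_betw_nat_finite[OF T(1)] by (auto simp: m_def atLeast0LessThan)
  have eT: "e i \<in> T" if "i < m" for i using e that bij_betwE by blast
  have inj: "e i \<noteq> e j" if "i < m" "j < m" "i \<noteq> j" for i j
    using e that by (auto simp: bij_betw_def inj_on_def)
  have mn: "m \<le> n" using T m_def by simp
  have hank: "a j = 0" if k: "k \<le> m" and x: "x \<in> J"
    and a: "\<And>i. i < k \<Longrightarrow> (\<Sum>j<k. a j * (deriv ^^ i) ((deriv ^^ j) g) x) = 0" and j: "j < k" for k x a j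
  proof (rule ccontr)
    assume nz: "a j \<noteq> 0"
    define v where "v = (\<lambda>i. if i < k then a i else 0)"
    have "quad_form {..<n} (\<lambda>i j. (deriv ^^ (i + j)) g x) v = quad_form {..<k} (\<lambda>i j. (deriv ^^ (i + j)) g x) v"
      by (rule quad_form_subset[symmetric]) (use k mn in \<open>auto simp: v_def\<close>)
    also have "\<dots> = (\<Sum>t<k. v t * (\<Sum>s<k. a s * (deriv ^^ t) ((deriv ^^ s) g) x))"
      unfolding quad_form_row by (auto simp: v_def funpow_add add.commute intro!: sum.cong)
    also have "\<dots> = 0" using a by simp
    finally have "quad_form {..<n} (\<lambda>i j. (deriv ^^ (i + j)) g x) v = 0" .
    moreover have "\<exists>s\<in>{..<n}. v s \<noteq> 0" using nz j k mn by (intro bexI[of _ j]) (auto simp: v_def)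
    ultimately show False using pd[OF x] unfolding pd_on_def by force
  qed
  have step1: "a j = 0" if k: "k \<le> m" and tau: "\<And>i. i < k \<Longrightarrow> tau + e i \<in> J"
    and a: "\<And>i. i < k \<Longrightarrow> (\<Sum>j<k. a j * (deriv ^^ j) g (tau + e i)) = 0" and j: "j < k" for k tau a j
  proof (rule chebyshev_system_zeros[OF J, of k "\<lambda>j. (deriv ^^ j) g" "(\<lambda>i. tau + e i) ` {..<k}" a])
    show "C_k_on (k - 1) J ((deriv ^^ j) g)" if "j < k" for j
      by (rule C_k_on_funpow_deriv, rule C_k_on_mono[OF g]) (use that k mn in auto)
    show "card ((\<lambda>i. tau + e i) ` {..<k}) = k"
    proof -
      have "inj_on (\<lambda>i. tau + e i) {..<k}"
        using k inj unfolding inj_on_def by (metis add_left_cancel lessThan_iff order_less_le_trans)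
      then show ?thesis by (simp add: card_image)
    qed
    show "a j = 0" if "k' \<le> k" "x \<in> J" "\<And>i. i < k' \<Longrightarrow> (\<Sum>j<k'. a j * (deriv ^^ i) ((deriv ^^ j) g) x) = 0" "j < k'"
      for k' x a j using hank[of k' x a j] that k by auto
  qed (use tau a j in auto)
  \<comment> \<open>The arguments at which all translates are defined. This intersection of shifted
    copies of \<open>J\<close> contains \<open>T\<close>, because sums of two points of
    \<open>T\<close> lie in \<open>J\<close>.\<close>
  define K where "K = (\<Inter>i<m. (\<lambda>t. t + e i) -` J)"
  have Ki: "t \<in> K \<longleftrightarrow> (\<forall>i<m. t + e i \<in> J)" for t by (auto simp: K_def)
  have K: "open K" "is_interval K"
  proof -
    show "open K"
      unfolding K_def using J(1) by (auto intro!: open_INT open_vimage continuous_intros)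
    have "x + e i \<in> J" if "a \<in> K" "b \<in> K" "a \<le> x" "x \<le> b" "i < m" for a b x i
      using that J(2) unfolding is_interval_1 Ki by (meson add_right_mono)
    then show "is_interval K" unfolding is_interval_1 by (metis Ki)
  qed
  have w: "(deriv ^^ j) (\<lambda>t. g (t + e i)) = (\<lambda>t. (deriv ^^ j) g (t + e i))" for i j
    by (rule funpow_deriv_shift)
  have "c (e i) = 0" if "i < m" for i
  proof (rule chebyshev_system_zeros[OF K, of m "\<lambda>i t. g (t + e i)" T "\<lambda>i. c (e i)"])
    show "C_k_on (m - 1) K (\<lambda>t. g (t + e i))" if "i < m" for i
      by (rule C_k_on_compose[OF J(1) K(1) C_k_on_mono[OF g] C_k_on_add[OF K(1) C_k_on_id C_k_on_const]])
        (use mn that Ki in auto)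
    show "a i = 0" if k: "k \<le> m" and x: "x \<in> K"
      and a: "\<And>j. j < k \<Longrightarrow> (\<Sum>i<k. a i * (deriv ^^ j) (\<lambda>t. g (t + e i)) x) = 0" and i: "i < k" for k x a i
    proof (rule left_kernel_trivial[of k "\<lambda>i j. (deriv ^^ j) g (x + e i)", OF _ _ i])
      show "b j = 0" if "\<And>i. i < k \<Longrightarrow> (\<Sum>j<k. b j * (deriv ^^ j) g (x + e i)) = 0" "j < k" for b j
        using step1[OF k _ that] x k Ki by auto
      show "(\<Sum>i<k. a i * (deriv ^^ j) g (x + e i)) = 0" if "j < k" for j
        using a[OF that] unfolding w .
    qed
    show "T \<subseteq> K" using T(3) eT by (auto simp: Ki add.commute)
    show "(\<Sum>i<m. c (e i) * g (z + e i)) = 0" if "z \<in> T" for z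
      using c[OF that] sum.reindex_bij_betw[OF e, of "\<lambda>s. c s * g (s + z)"] by (simp add: add.commute)
  qed (use T that in \<open>auto simp: m_def\<close>)
  then show ?thesis using s e by (auto simp: bij_betw_def)
qed

lemma quad_form_add_single:
  assumes S: "finite S" and M: "\<And>s t. s \<in> S \<Longrightarrow> t \<in> S \<Longrightarrow> M s t = M t s" and t: "t \<in> S"
  shows "quad_form S M (\<lambda>s. v s + l * of_bool (s = t)) =
    quad_form S M v + 2 * l * (\<Sum>s\<in>S. v s * M s t) + l\<^sup>2 * M t t"
proof -
  define b where "b = (\<Sum>s\<in>S. v s * M s t)"
  define d where "d = (\<lambda>r. of_bool (r = t) :: real)"
  have "quad_form S M (\<lambda>s. v s + l * d s) = quad_form S M v + l * (\<Sum>s\<in>S. \<Sum>r\<in>S. v s * d r * M s r)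
      + l * (\<Sum>s\<in>S. \<Sum>r\<in>S. d s * v r * M s r) + l\<^sup>2 * (\<Sum>s\<in>S. \<Sum>r\<in>S. d s * d r * M s r)"
    unfolding quad_form_def sum_distrib_left sum.distrib[symmetric]
    by (intro sum.cong refl) (simp add: algebra_simps power2_eq_square)
  moreover have "(\<Sum>s\<in>S. \<Sum>r\<in>S. v s * d r * M s r) = b"
  proof -
    have "v s * d r * M s r = (if r = t then v s * M s r else 0)" for s r by (simp add: d_def)
    then show ?thesis using S t by (simp add: b_def)
  qed
  moreover have "(\<Sum>s\<in>S. \<Sum>r\<in>S. d s * v r * M s r) = (\<Sum>r\<in>S. v r * M t r)"
  proof -
    have "d s * v r * M s r = (if s = t then v r * M s r else 0)" for s r by (simp add: d_def)
    then show ?thesis using S t by (subst sum.swap) simp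
  qed
  moreover have "(\<Sum>s\<in>S. \<Sum>r\<in>S. d s * d r * M s r) = M t t"
  proof -
    have "d s * d r * M s r = (if r = t then if s = t then M s r else 0 else 0)" for s r by (simp add: d_def)
    then show ?thesis using S t by simp
  qed
  moreover have "(\<Sum>r\<in>S. v r * M t r) = b"
    unfolding b_def using M t by (intro sum.cong) auto
  ultimately show ?thesis by (simp add: b_def d_def)
qed

text \<open>A null vector of a nonnegative form is a minimum point, so the derivative of the form in
  each coordinate direction is zero there.\<close>

lemma psd_on_kernel:
  assumes S: "finite S" and psd: "psd_on S M" and v: "quad_form S M v = 0" and t: "t \<in> S"
  shows "(\<Sum>s\<in>S. v s * M s t) = 0"
proof -
  define b where "b = (\<Sum>s\<in>S. v s * M s t)"
  have "quad_form S M (\<lambda>s. v s + l * of_bool (s = t)) = 2 * l * b + l\<^sup>2 * M t t" for l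
    using quad_form_add_single[OF S _ t, of M v l] psd v by (simp add: psd_on_def b_def)
  then have nn: "0 \<le> 2 * l * b + l\<^sup>2 * M t t" for l
    using psd unfolding psd_on_def by metis
  show ?thesis
  proof (rule ccontr)
    assume "\<not> ?thesis"
    then have b: "b \<noteq> 0" by (simp add: b_def)
    \<comment> \<open>Any positive \<open>c > M t t\<close> works: the step
      \<open>l = - b / c\<close> gives the value \<open>b^2 * (M t t - 2 * c) / c^2\<close>, which
      is negative.\<close>
    define c where "c = 1 + \<bar>M t t\<bar>"
    have c: "c > 0" "M t t < c" by (auto simp: c_def)
    have "2 * (- b / c) * b + (- b / c)\<^sup>2 * M t t = b\<^sup>2 * (M t t - 2 * c) / c\<^sup>2"
      using c by (simp add: field_simps power2_eq_square)
    moreover have "b\<^sup>2 * (M t t - 2 * c) < 0" using b c by (intro mult_pos_neg) auto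
    ultimately show False using nn[of "- b / c"] c by (simp add: divide_less_0_iff not_less[symmetric])
  qed
qed

text \<open>Coordinates outside \<open>S\<close> are fixed at zero, so the sphere is a closed subset
  of a product of compact sets, and Tychonoff's theorem applies.\<close>

lemma compact_unit_sphere_fun:
  assumes "finite S"
  shows "compact {v :: 'a \<Rightarrow> real. (\<forall>s. s \<notin> S \<longrightarrow> v s = 0) \<and> (\<Sum>s\<in>S. (v s)\<^sup>2) = 1}" (is "compact ?K")
proof -
  define B where "B = Pi\<^sub>E UNIV (\<lambda>s. if s \<in> S then {-1..1::real} else {0})"
  have "compactin (product_topology (\<lambda>_. euclidean) UNIV) B"
    unfolding B_def compactin_PiE by auto
  then have B: "compact B"
    by (simp add: euclidean_product_topology)
  have *: "continuous_on UNIV (\<lambda>v :: 'a \<Rightarrow> real. v s)" for s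
    by (rule continuous_on_product_coordinates)
  have "?K = (\<Inter>s\<in>-S. {v. v s = 0}) \<inter> {v. (\<Sum>s\<in>S. (v s)\<^sup>2) = 1}" by auto
  moreover have "closed ((\<Inter>s\<in>-S. {v. v s = 0}) \<inter> {v :: 'a \<Rightarrow> real. (\<Sum>s\<in>S. (v s)\<^sup>2) = 1})"
    by (intro closed_Int closed_INT ballI closed_Collect_eq continuous_intros *)
  ultimately have "closed ?K" by simp
  moreover have "?K \<subseteq> B"
  proof
    fix v assume v: "v \<in> ?K"
    have "\<bar>v s\<bar> \<le> 1" if "s \<in> S" for s
    proof -
      have "(v s)\<^sup>2 \<le> (\<Sum>s\<in>S. (v s)\<^sup>2)"
        by (rule member_le_sum) (use assms that in auto)
      then show ?thesis using v by (simp add: abs_square_le_1)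
    qed
    then have "v s \<in> (if s \<in> S then {-1..1} else {0})" for s
      using v by (auto simp: abs_le_iff minus_le_iff)
    then show "v \<in> B" unfolding B_def by (intro PiE_I) auto
  qed
  ultimately show ?thesis
    using compact_Int_closed[OF B, of ?K] by (simp only: Int_absorb1)
qed

text \<open>If \<open>G\<close> took a negative value, the minimum \<open>-m\<close> of the Rayleigh quotient of \<open>G\<close> relative
  to \<open>E\<close> would make \<open>G + m E\<close> singular.\<close>

lemma psd_on_if_pencil_nonsingular:
  assumes S: "finite S" and G: "\<And>s t. s \<in> S \<Longrightarrow> t \<in> S \<Longrightarrow> G s t = G t s" and E: "pd_on S E"
    and nonsing: "\<And>m v s. m > 0 \<Longrightarrow> (\<And>t. t \<in> S \<Longrightarrow> (\<Sum>s\<in>S. v s * (G s t + m * E s t)) = 0) \<Longrightarrow> s \<in> S \<Longrightarrow> v s = 0"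
  shows "psd_on S G"
proof (rule ccontr)
  assume "\<not> psd_on S G"
  then obtain w where w: "quad_form S G w < 0"
    using G unfolding psd_on_def by (meson not_le)
  define K where "K = {v :: 'a \<Rightarrow> real. (\<forall>s. s \<notin> S \<longrightarrow> v s = 0) \<and> (\<Sum>s\<in>S. (v s)\<^sup>2) = 1}"
  have Epos: "quad_form S E v > 0" if "v \<in> K" for v
  proof -
    have "\<exists>s\<in>S. v s \<noteq> 0"
    proof (rule ccontr)
      assume "\<not> ?thesis"
      then show False using that by (simp add: K_def)
    qed
    then show ?thesis using E unfolding pd_on_def by blast
  qed
  define q where "q = (\<lambda>v. quad_form S G v / quad_form S E v)"
  have normalize: "\<exists>c u. u \<in> K \<and> c > 0 \<and> (\<forall>s\<in>S. v s = c * u s)" if "\<exists>s\<in>S. v s \<noteq> 0" for v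
  proof -
    define c where "c = sqrt (\<Sum>s\<in>S. (v s)\<^sup>2)"
    from that obtain s where "s \<in> S" "v s \<noteq> 0" by blast
    then have "(\<Sum>s\<in>S. (v s)\<^sup>2) > 0" using S by (intro sum_pos2[of S s]) auto
    then have c: "c > 0" "c\<^sup>2 = (\<Sum>s\<in>S. (v s)\<^sup>2)" by (auto simp: c_def)
    define u where "u = (\<lambda>s. if s \<in> S then v s / c else 0)"
    have "(\<Sum>s\<in>S. (u s)\<^sup>2) = (\<Sum>s\<in>S. (v s)\<^sup>2) / c\<^sup>2"
      by (simp add: u_def power_divide sum_divide_distrib)
    then have "u \<in> K" using c by (auto simp: K_def u_def)
    then show ?thesis using c by (intro exI[of _ c] exI[of _ u]) (auto simp: u_def)
  qed
  have "\<exists>s\<in>S. w s \<noteq> 0"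
  proof (rule ccontr)
    assume "\<not> ?thesis"
    then have "quad_form S G w = 0" by (simp add: quad_form_def)
    then show False using w by simp
  qed
  from normalize[OF this] obtain c u where u: "u \<in> K" "c > 0" "\<And>s. s \<in> S \<Longrightarrow> w s = c * u s" by blast
  have "quad_form S G w = c\<^sup>2 * quad_form S G u"
    unfolding quad_form_scale[symmetric] using u by (intro quad_form_cong) auto
  then have "quad_form S G u < 0" using w u(2) by (simp add: mult_less_0_iff)
  then have qu: "q u < 0" using Epos[OF u(1)] by (simp add: q_def divide_neg_pos)
  have cq: "continuous_on K (quad_form S M)" for M :: "'a \<Rightarrow> 'a \<Rightarrow> real"
    unfolding quad_form_def
    by (intro continuous_intros continuous_on_subset[OF continuous_on_product_coordinates]) auto
  have "continuous_on K q"
    unfolding q_def by (intro continuous_on_divide cq) (use Epos in force)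
  moreover have "compact K" unfolding K_def by (rule compact_unit_sphere_fun[OF S])
  ultimately obtain v where v: "v \<in> K" "\<And>x. x \<in> K \<Longrightarrow> q v \<le> q x"
    using continuous_attains_inf[of K q] u(1) by blast
  define m where "m = - q v"
  have m: "m > 0" using v(2)[OF u(1)] qu by (simp add: m_def)
  let ?R = "\<lambda>s t. G s t + m * E s t"
  have R: "quad_form S ?R x = quad_form S G x + m * quad_form S E x" for x
    by (simp add: quad_form_add quad_form_cmult)
  have RK: "quad_form S ?R x \<ge> 0" if "x \<in> K" for x
    using v(2)[OF that] Epos[OF that] unfolding R by (simp add: q_def m_def field_simps)
  have psd: "psd_on S ?R"
    unfolding psd_on_def
  proof (intro conjI ballI allI)
    fix s t assume "s \<in> S" "t \<in> S"
    then show "?R s t = ?R t s" using G E by (simp add: pd_on_def)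
  next
    fix x show "0 \<le> quad_form S ?R x"
    proof (cases "\<exists>s\<in>S. x s \<noteq> 0")
      case False
      then show ?thesis by (simp add: quad_form_def)
    next
      case True
      from normalize[OF this] obtain c u where u: "u \<in> K" "c > 0" "\<And>s. s \<in> S \<Longrightarrow> x s = c * u s" by blast
      have "quad_form S ?R x = c\<^sup>2 * quad_form S ?R u"
        unfolding quad_form_scale[symmetric] using u by (intro quad_form_cong) auto
      then show ?thesis using RK[OF u(1)] by simp
    qed
  qed
  \<comment> \<open>By the choice of \<open>m\<close> the form of \<open>?R\<close> vanishes at the
    minimizer, which is therefore a kernel vector; \<open>nonsing\<close> then contradicts its norm
    being one.\<close>
  have "quad_form S ?R v = 0"
    unfolding R using Epos[OF v(1)] by (simp add: q_def m_def)
  then have "v s = 0" if "s \<in> S" for s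
    using nonsing[OF m] psd_on_kernel[OF S psd] that by blast
  then show False using v(1) by (simp add: K_def)
qed

lemma psd_add_pd:
  assumes "psd_on S M" "pd_on S N" "m > 0"
  shows "pd_on S (\<lambda>s t. M s t + m * N s t)"
  using assms unfolding psd_on_def pd_on_def quad_form_add quad_form_cmult
  by (simp add: add_nonneg_pos)

section \<open>Perturbation by a sum of exponentials\<close>

lemma funpow_deriv_exp_mult: "(deriv ^^ j) (\<lambda>t::real. exp (c * t)) = (\<lambda>t. c ^ j * exp (c * t))"
proof (induction j)
  case (Suc j)
  have "((\<lambda>t. c ^ j * exp (c * t)) has_real_derivative c ^ Suc j * exp (c * t)) (at t)" for t
    by (auto intro!: derivative_eq_intros)
  then have "deriv (\<lambda>t. c ^ j * exp (c * t)) = (\<lambda>t. c ^ Suc j * exp (c * t))"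
    using DERIV_imp_deriv by blast
  then show ?case using Suc by simp
qed simp

text \<open>The Hankel form at \<open>t\<close> is the sum over \<open>k < n\<close> of
  \<open>exp (k * t) * (p k)^2\<close>, where \<open>p\<close> is the polynomial with coefficients
  \<open>v\<close>. A nonzero polynomial of degree below \<open>n\<close> cannot vanish at all of
  \<open>0, ..., n - 1\<close>. The kernel form is a sum of squares as well.\<close>

lemma exp_sum_hankel_pd:
  fixes t :: real and n :: nat
  defines "e \<equiv> (\<lambda>t. \<Sum>k<n. exp (real k * t))"
  shows "C_k_on m UNIV e" "pd_on {..<n} (\<lambda>i j. (deriv ^^ (i + j)) e t)"
    and "0 \<le> quad_form T (\<lambda>s t. e (s + t)) v"
proof -
  have C: "C_k_on m UNIV (\<lambda>t. exp (real k * t))" for k m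
    by (intro C_k_on_compose[OF open_UNIV open_UNIV C_k_on_exp C_k_on_cmult[OF open_UNIV C_k_on_id]]) auto
  then show "C_k_on m UNIV e" unfolding e_def by (intro C_k_on_sum) auto
  have d: "(deriv ^^ j) e t = (\<Sum>k<n. real k ^ j * exp (real k * t))" for j t
    using funpow_deriv_sum[of UNIV "{..<n}" j "\<lambda>k t. exp (real k * t)" t j] C
    by (simp add: e_def funpow_deriv_exp_mult)
  have q: "quad_form {..<n} (\<lambda>i j. (deriv ^^ (i + j)) e t) v = (\<Sum>k<n. exp (real k * t) * (\<Sum>i<n. v i * real k ^ i)\<^sup>2)" for v
  proof -
    have "quad_form {..<n} (\<lambda>i j. (deriv ^^ (i + j)) e t) v
       = (\<Sum>i<n. \<Sum>j<n. \<Sum>k<n. exp (real k * t) * ((v i * real k ^ i) * (v j * real k ^ j)))"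
      unfolding quad_form_def d by (simp add: sum_distrib_left power_add mult_ac)
    also have "\<dots> = (\<Sum>i<n. \<Sum>k<n. \<Sum>j<n. exp (real k * t) * ((v i * real k ^ i) * (v j * real k ^ j)))"
      by (rule sum.cong[OF refl]) (rule sum.swap)
    also have "\<dots> = (\<Sum>k<n. \<Sum>i<n. \<Sum>j<n. exp (real k * t) * ((v i * real k ^ i) * (v j * real k ^ j)))"
      by (rule sum.swap)
    also have "\<dots> = (\<Sum>k<n. exp (real k * t) * (\<Sum>i<n. v i * real k ^ i)\<^sup>2)"
    proof -
      have "(\<Sum>i<n. v i * real k ^ i)\<^sup>2 = (\<Sum>i<n. \<Sum>j<n. (v i * real k ^ i) * (v j * real k ^ j))" for k
        by (simp only: power2_eq_square sum_product)
      then show ?thesis by (simp add: sum_distrib_left)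
    qed
    finally show ?thesis .
  qed
  show "pd_on {..<n} (\<lambda>i j. (deriv ^^ (i + j)) e t)"
    unfolding pd_on_def
  proof (intro conjI ballI allI impI)
    fix v assume v: "\<exists>s\<in>{..<n}. v s \<noteq> (0::real)"
    have "\<exists>k<n. (\<Sum>i<n. v i * real k ^ i) \<noteq> 0"
    proof (rule ccontr)
      assume "\<not> ?thesis"
      then have z: "\<And>k. k < n \<Longrightarrow> (\<Sum>i<n. v i * real k ^ i) = 0" by blast
      obtain n' where n': "n = Suc n'" using v by (cases n) auto
      obtain s where s: "s \<le> n'" "v s \<noteq> 0" using v n' by (auto simp: less_Suc_eq_le)
      have "real ` {..<n} \<subseteq> {x. (\<Sum>i\<le>n'. v i * x ^ i) = 0}"
        using z n' by (auto simp: lessThan_Suc_atMost)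
      moreover have "finite {x. (\<Sum>i\<le>n'. v i * x ^ i) = 0}" "card {x. (\<Sum>i\<le>n'. v i * x ^ i) = 0} \<le> n'"
        using polyfun_rootbound[of v s n'] s by auto
      ultimately have "card (real ` {..<n}) \<le> n'" by (meson card_mono order_trans)
      then show False using n' by (simp add: card_image)
    qed
    then obtain k where k: "k < n" "(\<Sum>i<n. v i * real k ^ i) \<noteq> 0" by blast
    show "0 < quad_form {..<n} (\<lambda>i j. (deriv ^^ (i + j)) e t) v"
      unfolding q by (rule sum_pos2[of _ k]) (use k in auto)
  qed (simp add: add.commute)
  have "quad_form T (\<lambda>s t. e (s + t)) v = (\<Sum>k<n. (\<Sum>s\<in>T. v s * exp (real k * s))\<^sup>2)"
  proof -
    have "quad_form T (\<lambda>s t. e (s + t)) v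
       = (\<Sum>i\<in>T. \<Sum>j\<in>T. \<Sum>k<n. (v i * exp (real k * i)) * (v j * exp (real k * j)))"
      unfolding quad_form_def e_def by (simp add: sum_distrib_left exp_add distrib_left mult_ac)
    also have "\<dots> = (\<Sum>i\<in>T. \<Sum>k<n. \<Sum>j\<in>T. (v i * exp (real k * i)) * (v j * exp (real k * j)))"
      by (rule sum.cong[OF refl]) (rule sum.swap)
    also have "\<dots> = (\<Sum>k<n. \<Sum>i\<in>T. \<Sum>j\<in>T. (v i * exp (real k * i)) * (v j * exp (real k * j)))"
      by (rule sum.swap)
    finally show ?thesis by (simp add: power2_eq_square sum_product)
  qed
  then show "0 \<le> quad_form T (\<lambda>s t. e (s + t)) v" by (simp add: sum_nonneg)
qed

text \<open>For \<open>m > 0\<close> the function \<open>g + m e\<close> has positive definite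
  Hankel matrices, so its kernel on \<open>T\<close> is nonsingular. The pencil criterion then
  excludes negative values of the form of \<open>g\<close>.\<close>

lemma gram_psd_finite:
  assumes J: "open J" "is_interval J" and g: "C_k_on (2 * n - 2) J g"
    and psd: "\<And>x. x \<in> J \<Longrightarrow> psd_on {..<n} (\<lambda>i j. (deriv ^^ (i + j)) g x)"
    and T: "finite T" "card T \<le> n" "\<And>s t. s \<in> T \<Longrightarrow> t \<in> T \<Longrightarrow> s + t \<in> J"
  shows "psd_on T (\<lambda>s t. g (s + t))"
proof -
  define e where "e = (\<lambda>t. \<Sum>k<n. exp (real k * t))"
  have eC: "C_k_on m UNIV e" and epd: "pd_on {..<n} (\<lambda>i j. (deriv ^^ (i + j)) e t)"
    and epsd: "0 \<le> quad_form T (\<lambda>s t. e (s + t)) v" for m t v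
    unfolding e_def by (rule exp_sum_hankel_pd)+
  have eE: "psd_on T (\<lambda>s t. e (s + t))"
    using epsd by (simp add: psd_on_def add.commute)
  \<comment> \<open>A null vector of the semidefinite kernel of \<open>e\<close> is a kernel vector,
    and nonsingularity applied to \<open>e\<close> on the whole line leaves only zero.\<close>
  have E: "pd_on T (\<lambda>s t. e (s + t))"
    unfolding pd_on_def
  proof (intro conjI ballI allI impI)
    fix v assume "\<exists>s\<in>T. v s \<noteq> (0::real)"
    then obtain s where s: "s \<in> T" "v s \<noteq> 0" by blast
    show "0 < quad_form T (\<lambda>s t. e (s + t)) v"
    proof (rule ccontr)
      assume "\<not> ?thesis"
      then have "quad_form T (\<lambda>s t. e (s + t)) v = 0" using epsd[of v] by simp
      then have "(\<Sum>s\<in>T. v s * e (s + t)) = 0" if "t \<in> T" for t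
        using psd_on_kernel[OF T(1) eE _ that] by blast
      then show False
        using gram_nonsingular[OF open_UNIV _ eC epd T(1,2), of v s] s by auto
    qed
  qed (simp add: add.commute)
  show ?thesis
  proof (rule psd_on_if_pencil_nonsingular[OF T(1) _ E])
    fix m v s assume m: "m > (0::real)" and s: "s \<in> T"
      and z: "\<And>t. t \<in> T \<Longrightarrow> (\<Sum>s\<in>T. v s * (g (s + t) + m * e (s + t))) = 0"
    have mC: "C_k_on (2 * n - 2) J (\<lambda>x. m * e x)"
      by (rule C_k_on_cmult[OF J(1) C_k_on_subset[OF eC]]) simp
    have d: "(deriv ^^ (i + j)) (\<lambda>x. g x + m * e x) x = (deriv ^^ (i + j)) g x + m * (deriv ^^ (i + j)) e x"
      if "x \<in> J" "i < n" "j < n" for x i j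
    proof -
      have "i + j \<le> 2 * n - 2" using that by simp
      then show ?thesis
        using funpow_deriv_add[OF J(1) g mC that(1)]
          funpow_deriv_cmult[OF J(1) C_k_on_subset[OF eC[of "2 * n - 2"]] that(1)] by simp
    qed
    show "v s = 0"
    proof (rule gram_nonsingular[OF J _ _ T z s])
      show "C_k_on (2 * n - 2) J (\<lambda>x. g x + m * e x)" by (rule C_k_on_add[OF J(1) g mC])
      fix x assume x: "x \<in> J"
      have "pd_on {..<n} (\<lambda>i j. (deriv ^^ (i + j)) g x + m * (deriv ^^ (i + j)) e x)"
        by (rule psd_add_pd[OF psd[OF x] epd m])
      then show "pd_on {..<n} (\<lambda>i j. (deriv ^^ (i + j)) (\<lambda>x. g x + m * e x) x)"
        unfolding pd_on_def
        using d[OF x] quad_form_cong[of "{..<n}" "\<lambda>i j. (deriv ^^ (i + j)) (\<lambda>x. g x + m * e x) x"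
          "\<lambda>i j. (deriv ^^ (i + j)) g x + m * (deriv ^^ (i + j)) e x"]
        by (simp add: add.commute)
    qed
  qed (simp add: add.commute)
qed

text \<open>\<open>h\<close> may identify indices; the coefficients of indices with the same image
  are added. In the next lemma this merges coinciding points \<open>t i\<close>.\<close>

lemma quad_form_image:
  assumes "finite A"
  shows "quad_form A (\<lambda>i j. G (h i) (h j)) v = quad_form (h ` A) G (\<lambda>s. \<Sum>i | i \<in> A \<and> h i = s. v i)"
proof -
  have *: "(\<Sum>i\<in>A. v i * F (h i)) = (\<Sum>s\<in>h ` A. (\<Sum>i | i \<in> A \<and> h i = s. v i) * F s)" for F
  proof -
    have "(\<Sum>i\<in>A. v i * F (h i)) = (\<Sum>s\<in>h ` A. \<Sum>i | i \<in> A \<and> h i = s. v i * F (h i))"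
      by (rule sum.group[symmetric]) (use assms in auto)
    then show ?thesis by (simp add: sum_distrib_right)
  qed
  have "quad_form A (\<lambda>i j. G (h i) (h j)) v = (\<Sum>i\<in>A. v i * (\<Sum>j\<in>A. v j * G (h i) (h j)))"
    by (simp add: quad_form_def sum_distrib_left mult_ac)
  also have "\<dots> = (\<Sum>s\<in>h ` A. (\<Sum>i | i \<in> A \<and> h i = s. v i) * (\<Sum>j\<in>A. v j * G s (h j)))"
    by (rule *)
  also have "\<dots> = (\<Sum>s\<in>h ` A. (\<Sum>i | i \<in> A \<and> h i = s. v i) *
      (\<Sum>t\<in>h ` A. (\<Sum>i | i \<in> A \<and> h i = t. v i) * G s t))"
    by (intro sum.cong arg_cong2[where f = "(*)"] refl *)
  also have "\<dots> = quad_form (h ` A) G (\<lambda>s. \<Sum>i | i \<in> A \<and> h i = s. v i)"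
    by (simp add: quad_form_def sum_distrib_left mult_ac)
  finally show ?thesis .
qed

lemma gram_psd:
  assumes J: "open J" "is_interval J" and g: "C_k_on (2 * n - 2) J g"
    and psd: "\<And>x. x \<in> J \<Longrightarrow> psd_on {..<n} (\<lambda>i j. (deriv ^^ (i + j)) g x)"
    and t: "\<And>i j. i < n \<Longrightarrow> j < n \<Longrightarrow> t i + t j \<in> J"
  shows "psd_on {..<n} (\<lambda>i j. g (t i + t j))"
proof -
  have "psd_on (t ` {..<n}) (\<lambda>s t. g (s + t))"
    by (rule gram_psd_finite[OF J g psd]) (use t card_image_le[of "{..<n}" t] in auto)
  then show ?thesis
    using quad_form_image[of "{..<n}" "\<lambda>s t. g (s + t)" t]
    by (simp add: psd_on_def add.commute)
qed

section \<open>Schur products\<close>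

lemma psd_on_sym: "psd_on S M \<Longrightarrow> s \<in> S \<Longrightarrow> t \<in> S \<Longrightarrow> M s t = M t s"
  by (simp add: psd_on_def)

lemma psd_on_nonneg: "psd_on S M \<Longrightarrow> 0 \<le> quad_form S M v"
  by (simp add: psd_on_def)

lemma psd_on_cong:
  assumes "\<And>s t. s \<in> S \<Longrightarrow> t \<in> S \<Longrightarrow> M s t = N s t"
  shows "psd_on S M \<longleftrightarrow> psd_on S N"
  unfolding psd_on_def using assms quad_form_cong[of S M N] by (metis (no_types, lifting))

lemma psd_on_subset:
  assumes "finite S" "T \<subseteq> S" "psd_on S M"
  shows "psd_on T M"
  unfolding psd_on_def
proof (intro conjI ballI allI)
  fix v :: "_ \<Rightarrow> real"
  let ?w = "\<lambda>s. if s \<in> T then v s else 0"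
  have "quad_form T M v = quad_form T M ?w" by (rule quad_form_cong) auto
  also have "\<dots> = quad_form S M ?w" by (rule quad_form_subset) (use assms in auto)
  finally show "0 \<le> quad_form T M v" using psd_on_nonneg[OF assms(3)] by simp
qed (rule psd_on_sym[OF assms(3)]; use assms(2) in blast)

lemma psd_on_add:
  assumes "psd_on S M" "psd_on S N"
  shows "psd_on S (\<lambda>s t. M s t + N s t)"
  using assms by (simp add: psd_on_def quad_form_add)

lemma psd_on_cmult:
  assumes "psd_on S M" "0 \<le> c"
  shows "psd_on S (\<lambda>s t. c * M s t)"
  using assms by (simp add: psd_on_def quad_form_cmult)

lemma psd_on_congruence:
  assumes "psd_on S M"
  shows "psd_on S (\<lambda>s t. d s * d t * M s t)"
proof -
  have "quad_form S (\<lambda>s t. d s * d t * M s t) v = quad_form S M (\<lambda>s. v s * d s)" for v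
    by (simp add: quad_form_def mult_ac)
  then show ?thesis using assms by (simp add: psd_on_def mult_ac)
qed

lemma psd_on_rank1: "psd_on S (\<lambda>s t. d s * d t)"
proof -
  have "quad_form S (\<lambda>s t. d s * d t) v = (\<Sum>s\<in>S. v s * d s)\<^sup>2" for v
    by (simp add: quad_form_def power2_eq_square sum_product mult_ac)
  then show ?thesis by (simp add: psd_on_def mult.commute)
qed

lemma psd_on_diag:
  assumes "finite S" "psd_on S M" "t \<in> S"
  shows "quad_form S M (\<lambda>s. of_bool (s = t)) = M t t" "0 \<le> M t t"
proof -
  show "quad_form S M (\<lambda>s. of_bool (s = t)) = M t t"
    using quad_form_add_single[OF assms(1) psd_on_sym[OF assms(2)] assms(3), where v = "\<lambda>_. 0" and l = 1]
    by (simp add: quad_form_def)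
  then show "0 \<le> M t t" using psd_on_nonneg[OF assms(2)] by metis
qed

lemma psd_on_zero_diag:
  assumes "finite S" "psd_on S M" "t \<in> S" "M t t = 0" "s \<in> S"
  shows "M t s = 0"
proof -
  have "(\<Sum>r\<in>S. of_bool (r = t) * M r s) = 0"
    by (rule psd_on_kernel[OF assms(1,2) _ assms(5)]) (simp add: psd_on_diag[OF assms(1-3)] assms(4))
  moreover have "of_bool (r = t) * M r s = (if r = t then M r s else 0)" for r by simp
  ultimately show ?thesis using assms by simp
qed

text \<open>Completing the square: the new form at \<open>v\<close> is the old form at the point
  reached from \<open>v\<close> by minimizing along coordinate \<open>p\<close>.\<close>

lemma psd_on_schur_complement:
  assumes S: "finite S" and M: "psd_on S M" and p: "p \<in> S" "M p p > 0"
  shows "psd_on S (\<lambda>s t. M s t - M s p * M t p / M p p)"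
  unfolding psd_on_def
proof (intro conjI ballI allI)
  fix v :: "_ \<Rightarrow> real"
  define b where "b = (\<Sum>s\<in>S. v s * M s p)"
  have "quad_form S M (\<lambda>s. v s + (- b / M p p) * of_bool (s = p)) = quad_form S M v - b\<^sup>2 / M p p"
  proof -
    have "quad_form S M (\<lambda>s. v s + (- b / M p p) * of_bool (s = p)) =
        quad_form S M v + 2 * (- b / M p p) * b + (- b / M p p)\<^sup>2 * M p p"
      unfolding b_def by (rule quad_form_add_single[OF S psd_on_sym[OF M] p(1)])
    then show ?thesis using p(2) by (simp add: field_simps power2_eq_square)
  qed
  moreover have "quad_form S (\<lambda>s t. M s p * M t p) v = b\<^sup>2"
    by (simp add: quad_form_def b_def power2_eq_square sum_product mult_ac)
  moreover have "quad_form S (\<lambda>s t. M s t - M s p * M t p / M p p) v =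
      quad_form S M v + (- 1 / M p p) * quad_form S (\<lambda>s t. M s p * M t p) v"
    unfolding quad_form_cmult[symmetric] quad_form_add[symmetric] by simp
  ultimately show "0 \<le> quad_form S (\<lambda>s t. M s t - M s p * M t p / M p p) v"
    using psd_on_nonneg[OF M, of "\<lambda>s. v s + (- b / M p p) * of_bool (s = p)"] by simp
qed (simp add: psd_on_sym[OF M] mult.commute)

text \<open>Subtracting the rank one part at the pivot \<open>p\<close> leaves a matrix with zero
  row and column \<open>p\<close>, for which the sum runs over the smaller set. The rank one part
  contributes a value of the quadratic form of \<open>N\<close>.\<close>

lemma psd_on_trace_nonneg:
  assumes "finite S" "psd_on S M" "psd_on S N"
  shows "0 \<le> (\<Sum>s\<in>S. \<Sum>t\<in>S. M s t * N s t)"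
  using assms
proof (induction S arbitrary: M rule: finite_induct)
  case empty
  then show ?case by simp
next
  case (insert p S)
  have fin: "finite (insert p S)" using insert by simp
  have N: "psd_on S N" using psd_on_subset[OF fin _ insert.prems(2)] by auto
  have reduce: "0 \<le> (\<Sum>s\<in>insert p S. \<Sum>t\<in>insert p S. L s t * N s t)"
    if L: "psd_on (insert p S) L" and z: "\<And>s. s \<in> insert p S \<Longrightarrow> L p s = 0" for L
  proof -
    have "L s p = 0" if "s \<in> insert p S" for s
      using z[OF that] psd_on_sym[OF L that, of p] by simp
    then have "(\<Sum>s\<in>insert p S. \<Sum>t\<in>insert p S. L s t * N s t) = (\<Sum>s\<in>S. \<Sum>t\<in>S. L s t * N s t)"
      using insert.hyps z by simp
    also have "\<dots> \<ge> 0" by (rule insert.IH[OF _ N]) (use psd_on_subset[OF fin _ L] in auto)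
    finally show ?thesis .
  qed
  note M = insert.prems(1)
  show ?case
  proof (cases "M p p = 0")
    case True
    then show ?thesis using reduce[OF M] psd_on_zero_diag[OF fin M, of p] by simp
  next
    case False
    then have pp: "M p p > 0" using psd_on_diag(2)[OF fin M, of p] by simp
    let ?L = "\<lambda>s t. M s t - M s p * M t p / M p p"
    have "(\<Sum>s\<in>insert p S. \<Sum>t\<in>insert p S. M s t * N s t) =
       (\<Sum>s\<in>insert p S. \<Sum>t\<in>insert p S. ?L s t * N s t) + quad_form (insert p S) N (\<lambda>s. M s p) / M p p"
      unfolding quad_form_def sum_divide_distrib sum.distrib[symmetric]
      by (intro sum.cong refl) (simp add: algebra_simps)
    moreover have "0 \<le> (\<Sum>s\<in>insert p S. \<Sum>t\<in>insert p S. ?L s t * N s t)"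
      by (rule reduce[OF psd_on_schur_complement[OF fin M _ pp]])
        (use pp psd_on_sym[OF M] in auto)
    moreover have "0 \<le> quad_form (insert p S) N (\<lambda>s. M s p) / M p p"
      using pp psd_on_nonneg[OF insert.prems(2)] by simp
    ultimately show ?thesis by simp
  qed
qed

text \<open>Schur's product theorem: rescaling \<open>N\<close> by the diagonal matrix of
  \<open>v\<close> turns the quadratic form of the entrywise product into the sum of the previous
  lemma.\<close>

lemma psd_on_hadamard_nonneg:
  assumes "finite S" "psd_on S M" "psd_on S N"
  shows "0 \<le> quad_form S (\<lambda>s t. M s t * N s t) v"
  using psd_on_trace_nonneg[OF assms(1,2) psd_on_congruence[OF assms(3), of v]]
  by (simp add: quad_form_def mult_ac)

section \<open>Finite differences\<close>

definition fdiff :: "real \<Rightarrow> (real \<Rightarrow> real) \<Rightarrow> real \<Rightarrow> real" where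
  "fdiff h g = (\<lambda>t. g (t + h) - g t)"

text \<open>The signed binomial coefficients \<open>(-1)^(i-k) * (i choose k)\<close> of the
  \<open>i\<close>th forward difference, by Pascal's recursion.\<close>

fun fdiff_coeff :: "nat \<Rightarrow> nat \<Rightarrow> real" where
  "fdiff_coeff 0 k = of_bool (k = 0)"
| "fdiff_coeff (Suc i) k = (if k = 0 then 0 else fdiff_coeff i (k - 1)) - fdiff_coeff i k"

lemma fdiff_coeff_eq_0: "i < k \<Longrightarrow> fdiff_coeff i k = 0"
  by (induction i arbitrary: k) auto

text \<open>Coefficients with index above \<open>i\<close> are zero, so one upper limit
  \<open>n\<close> serves all rows of a matrix of differences.\<close>

lemma fdiff_funpow_eq_sum:
  "i < n \<Longrightarrow> (fdiff h ^^ i) g t = (\<Sum>k<n. fdiff_coeff i k * g (t + real k * h))"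
proof (induction i arbitrary: t)
  case 0
  have "(\<Sum>k<n. fdiff_coeff 0 k * g (t + real k * h)) = (\<Sum>k<n. if k = 0 then g t else 0)"
    by (intro sum.cong) auto
  then show ?case using 0 by simp
next
  case (Suc i)
  obtain m where m: "n = Suc m" using Suc.prems by (cases n) auto
  have "(\<Sum>k<n. (if k = 0 then 0 else fdiff_coeff i (k - 1)) * g (t + real k * h))
      = (\<Sum>k<m. fdiff_coeff i k * g (t + h + real k * h))"
    unfolding m sum.lessThan_Suc_shift by (simp add: algebra_simps)
  also have "\<dots> = (\<Sum>k<n. fdiff_coeff i k * g (t + h + real k * h))"
    using Suc.prems m by (simp add: fdiff_coeff_eq_0)
  also have "\<dots> = (fdiff h ^^ i) g (t + h)" using Suc by simp
  finally show ?case
    using Suc by (simp add: fdiff_def[of h "(fdiff h ^^ i) g"] left_diff_distrib sum_subtractf)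
qed

text \<open>The induction hypothesis for \<open>fdiff h g\<close> leaves an increment of
  \<open>(deriv ^^ m) g\<close>, to which the ordinary mean value theorem applies.\<close>

lemma fdiff_mean_value:
  assumes "open J" "C_k_on m J g" "{t..t + real m * h} \<subseteq> J" "h > 0"
  shows "\<exists>\<xi>\<in>{t..t + real m * h}. (fdiff h ^^ m) g t = h ^ m * (deriv ^^ m) g \<xi>"
  using assms
proof (induction m arbitrary: g J)
  case 0
  then show ?case by simp
next
  case (Suc m)
  define J' where "J' = J \<inter> (\<lambda>t. t + h) -` J"
  have J': "open J'" unfolding J'_def using Suc.prems(1)
    by (intro open_Int open_vimage continuous_intros)
  have g: "C_k_on m J g" using Suc.prems C_k_on_SucD by blast
  have gh: "C_k_on m J' (\<lambda>t. g (t + h))"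
    by (rule C_k_on_compose[OF Suc.prems(1) J' g C_k_on_add[OF J' C_k_on_id C_k_on_const]]) (auto simp: J'_def)
  have gJ': "C_k_on m J' g" by (rule C_k_on_subset[OF g]) (auto simp: J'_def)
  have gm: "C_k_on m J' (\<lambda>t. (- 1) * g t)" by (rule C_k_on_cmult[OF J' gJ'])
  have eq: "fdiff h g = (\<lambda>t. g (t + h) + (- 1) * g t)" by (simp add: fdiff_def)
  have fC: "C_k_on m J' (fdiff h g)" unfolding eq by (rule C_k_on_add[OF J' gh gm])
  have sub: "{t..t + real m * h} \<subseteq> J'"
  proof
    fix x assume x: "x \<in> {t..t + real m * h}"
    then have "x \<in> {t..t + real (Suc m) * h}" "x + h \<in> {t..t + real (Suc m) * h}"
      using Suc.prems(4) by (auto simp: algebra_simps)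
    then show "x \<in> J'" using Suc.prems(3) by (auto simp: J'_def)
  qed
  obtain \<xi> where \<xi>: "\<xi> \<in> {t..t + real m * h}"
    and d: "(fdiff h ^^ m) (fdiff h g) t = h ^ m * (deriv ^^ m) (fdiff h g) \<xi>"
    using Suc.IH[OF J' fC sub Suc.prems(4)] by blast
  have \<xi>J: "\<xi> \<in> J'" using \<xi> sub by blast
  have "(deriv ^^ m) (fdiff h g) \<xi> = (deriv ^^ m) g (\<xi> + h) - (deriv ^^ m) g \<xi>"
    unfolding eq using funpow_deriv_add[OF J' gh gm \<xi>J, of m] funpow_deriv_cmult[OF J' gJ' \<xi>J, of m "- 1"]
    by (simp add: funpow_deriv_shift)
  also have "\<exists>\<zeta>. \<xi> < \<zeta> \<and> \<zeta> < \<xi> + h \<and> (deriv ^^ m) g (\<xi> + h) - (deriv ^^ m) g \<xi> = (\<xi> + h - \<xi>) * (deriv ^^ Suc m) g \<zeta>"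
  proof (rule MVT2)
    fix x assume x: "\<xi> \<le> x" "x \<le> \<xi> + h"
    then have "x \<in> J" using \<xi> Suc.prems(3) by (auto simp: algebra_simps subset_iff)
    then show "((deriv ^^ m) g has_real_derivative (deriv ^^ Suc m) g x) (at x)"
      using C_k_on_has_deriv[OF Suc.prems(2)] by blast
  qed (use Suc.prems in simp)
  then obtain \<zeta> where \<zeta>: "\<xi> < \<zeta>" "\<zeta> < \<xi> + h"
    "(deriv ^^ m) g (\<xi> + h) - (deriv ^^ m) g \<xi> = h * (deriv ^^ Suc m) g \<zeta>" by auto
  ultimately have "(fdiff h ^^ Suc m) g t = h ^ Suc m * (deriv ^^ Suc m) g \<zeta>"
    using d by (simp add: funpow_Suc_right del: funpow.simps)
  moreover have "\<zeta> \<in> {t..t + real (Suc m) * h}" using \<xi> \<zeta> by (auto simp: algebra_simps)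
  ultimately show ?case by blast
qed

text \<open>The intermediate point supplied by a mean value theorem is unknown, but the interval
  containing it shrinks to \<open>a\<close>. Difference quotients and Taylor remainders are both
  treated this way.\<close>

lemma tendsto_right_between:
  fixes \<phi> :: "real \<Rightarrow> real"
  assumes "open J" "a \<in> J" "continuous_on J \<phi>" "c \<ge> 0"
    and "\<And>h. h > 0 \<Longrightarrow> {a..a + c * h} \<subseteq> J \<Longrightarrow> \<exists>\<xi>\<in>{a..a + c * h}. q h = \<phi> \<xi>"
  shows "(q \<longlongrightarrow> \<phi> a) (at_right 0)"
proof (rule tendstoI)
  fix e :: real assume e: "e > 0"
  have "isCont \<phi> a" using assms continuous_on_eq_continuous_at by blast
  then obtain d where d: "d > 0" "\<And>x. dist x a < d \<Longrightarrow> dist (\<phi> x) (\<phi> a) < e"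
    using e unfolding continuous_at_eps_delta by (metis dist_commute)
  obtain d' where d': "d' > 0" "ball a d' \<subseteq> J" using assms openE by blast
  have "((\<lambda>h. c * h) \<longlongrightarrow> c * 0) (at_right 0)" by (intro tendsto_intros)
  then have "\<forall>\<^sub>F h in at_right 0. c * h < min d d'"
    using order_tendstoD(2) d(1) d'(1) by (metis min_less_iff_conj mult_zero_right)
  moreover have "\<forall>\<^sub>F h in at_right 0. (0::real) < h" by (simp add: eventually_at_right_less)
  ultimately show "\<forall>\<^sub>F h in at_right 0. dist (q h) (\<phi> a) < e"
  proof eventually_elim
    case (elim h)
    have "{a..a + c * h} \<subseteq> ball a d'" using elim by (auto simp: dist_real_def)
    then obtain \<xi> where \<xi>: "\<xi> \<in> {a..a + c * h}" "q h = \<phi> \<xi>" using assms(5)[of h] elim d' by blast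
    then have "dist \<xi> a < d" using elim by (auto simp: dist_real_def)
    then show ?case using d \<xi> by simp
  qed
qed

lemma fdiff_tendsto_deriv:
  assumes J: "open J" "x \<in> J" and g: "C_k_on m J g"
  shows "((\<lambda>h. (fdiff h ^^ m) g x / h ^ m) \<longlongrightarrow> (deriv ^^ m) g x) (at_right 0)"
proof (rule tendsto_right_between[OF J, of _ "real m"])
  show "continuous_on J ((deriv ^^ m) g)" using g by (simp add: C_k_on_def)
next
  fix h :: real assume h: "h > 0" "{x..x + real m * h} \<subseteq> J"
  show "\<exists>\<xi>\<in>{x..x + real m * h}. (fdiff h ^^ m) g x / h ^ m = (deriv ^^ m) g \<xi>"
    using fdiff_mean_value[OF J(1) g h(2,1)] h(1) by auto
qed simp

text \<open>Congruence of matrices: the form of \<open>G\<close> at \<open>B^T w\<close> is the form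
  of \<open>B G B^T\<close> at \<open>w\<close>. For \<open>B\<close> the difference coefficients
  will be taken.\<close>

lemma quad_form_linear_image:
  "quad_form S G (\<lambda>k. \<Sum>i\<in>T. w i * B i k) = quad_form T (\<lambda>i j. \<Sum>k\<in>S. \<Sum>l\<in>S. B i k * B j l * G k l) w"
proof -
  let ?F = "\<lambda>i j k l. w i * w j * (B i k * B j l * G k l)"
  have "(\<Sum>i\<in>T. w i * B i k) * (\<Sum>j\<in>T. w j * B j l) * G k l = (\<Sum>i\<in>T. \<Sum>j\<in>T. ?F i j k l)" for k l
    unfolding sum_product unfolding sum_distrib_right by (simp add: mult_ac)
  then have "quad_form S G (\<lambda>k. \<Sum>i\<in>T. w i * B i k) = (\<Sum>k\<in>S. \<Sum>l\<in>S. \<Sum>i\<in>T. \<Sum>j\<in>T. ?F i j k l)"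
    by (simp add: quad_form_def)
  also have "\<dots> = (\<Sum>k\<in>S. \<Sum>i\<in>T. \<Sum>l\<in>S. \<Sum>j\<in>T. ?F i j k l)"
    by (rule sum.cong[OF refl], rule sum.swap)
  also have "\<dots> = (\<Sum>i\<in>T. \<Sum>k\<in>S. \<Sum>l\<in>S. \<Sum>j\<in>T. ?F i j k l)"
    by (rule sum.swap)
  also have "\<dots> = (\<Sum>i\<in>T. \<Sum>k\<in>S. \<Sum>j\<in>T. \<Sum>l\<in>S. ?F i j k l)"
    by (rule sum.cong[OF refl], rule sum.cong[OF refl], rule sum.swap)
  also have "\<dots> = (\<Sum>i\<in>T. \<Sum>j\<in>T. \<Sum>k\<in>S. \<Sum>l\<in>S. ?F i j k l)"
    by (rule sum.cong[OF refl], rule sum.swap)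
  finally show ?thesis by (simp add: quad_form_def sum_distrib_left)
qed

text \<open>An \<open>i\<close>th difference along rows and a \<open>j\<close>th difference along
  columns of the kernel make a difference of order \<open>i + j\<close>. So the matrix of difference
  quotients arises from the kernel by a congruence, and semidefiniteness survives the limit.\<close>

lemma hankel_psd_of_gram_psd:
  assumes J: "open J" "x \<in> J" and g: "C_k_on (2 * n - 2) J g"
    and gram: "\<forall>\<^sub>F h in at_right 0. psd_on {..<n} (\<lambda>i j. g (x + real (i + j) * h))"
  shows "psd_on {..<n} (\<lambda>i j. (deriv ^^ (i + j)) g x)"
  unfolding psd_on_def
proof (intro conjI ballI allI)
  fix v :: "nat \<Rightarrow> real"
  have "((\<lambda>h. quad_form {..<n} (\<lambda>i j. (fdiff h ^^ (i + j)) g x / h ^ (i + j)) v) \<longlongrightarrow>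
      quad_form {..<n} (\<lambda>i j. (deriv ^^ (i + j)) g x) v) (at_right 0)"
    unfolding quad_form_def
    by (intro tendsto_intros fdiff_tendsto_deriv[OF J] C_k_on_mono[OF g]) auto
  moreover have "\<forall>\<^sub>F h in at_right 0. 0 \<le> quad_form {..<n} (\<lambda>i j. (fdiff h ^^ (i + j)) g x / h ^ (i + j)) v"
    using gram
  proof eventually_elim
    case (elim h)
    have "(\<Sum>k<n. \<Sum>l<n. fdiff_coeff i k * fdiff_coeff j l * g (x + real (k + l) * h)) = (fdiff h ^^ (i + j)) g x"
      if "i < n" "j < n" for i j
    proof -
      have arg: "x + real k * h + real l * h = x + real (k + l) * h" for k l
        by (simp add: algebra_simps)
      have "(fdiff h ^^ (i + j)) g x = (fdiff h ^^ i) ((fdiff h ^^ j) g) x" by (simp add: funpow_add)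
      also have "\<dots> = (\<Sum>k<n. fdiff_coeff i k * (fdiff h ^^ j) g (x + real k * h))"
        by (rule fdiff_funpow_eq_sum[OF that(1)])
      also have "\<dots> = (\<Sum>k<n. fdiff_coeff i k * (\<Sum>l<n. fdiff_coeff j l * g (x + real k * h + real l * h)))"
        by (simp only: fdiff_funpow_eq_sum[OF that(2)])
      finally show ?thesis by (simp only: sum_distrib_left mult.assoc arg)
    qed
    \<comment> \<open>The divisor \<open>h ^ (i + j)\<close> factors and is absorbed into the vector
      \<open>v i / h ^ i\<close>.\<close>
    then have "quad_form {..<n} (\<lambda>i j. g (x + real (i + j) * h)) (\<lambda>k. \<Sum>i<n. v i / h ^ i * fdiff_coeff i k)
      = quad_form {..<n} (\<lambda>i j. (fdiff h ^^ (i + j)) g x) (\<lambda>i. v i / h ^ i)"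
      unfolding quad_form_linear_image by (intro quad_form_cong) auto
    also have "\<dots> = quad_form {..<n} (\<lambda>i j. (fdiff h ^^ (i + j)) g x / h ^ (i + j)) v"
      by (simp add: quad_form_def power_add)
    finally show ?case using psd_on_nonneg[OF elim, of "\<lambda>k. \<Sum>i<n. v i / h ^ i * fdiff_coeff i k"] by simp
  qed
  ultimately show "0 \<le> quad_form {..<n} (\<lambda>i j. (deriv ^^ (i + j)) g x) v"
    by (rule tendsto_lowerbound) simp
qed (simp add: add.commute)

section \<open>Necessary conditions on the derivatives of a preserver\<close>

lemma funpow_deriv_cmult_power: "(deriv ^^ m) (\<lambda>x::real. c * x ^ m) = (\<lambda>x. c * fact m)"
proof (induction m arbitrary: c)
  case (Suc m)
  have "deriv (\<lambda>x::real. c * x ^ Suc m) = (\<lambda>x. (c * real (Suc m)) * x ^ m)"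
  proof (rule ext, rule DERIV_imp_deriv)
    show "((\<lambda>x. c * x ^ Suc m) has_real_derivative c * real (Suc m) * x ^ m) (at x)" for x :: real
      using DERIV_cmult[OF DERIV_pow[of "Suc m" x UNIV], of c] by (simp add: mult.assoc del: power_Suc)
  qed
  then have "(deriv ^^ Suc m) (\<lambda>x. c * x ^ Suc m) = (deriv ^^ m) (\<lambda>x. (c * real (Suc m)) * x ^ m)"
    by (simp only: funpow_Suc_right comp_apply)
  then show ?case by (simp only: Suc.IH) (simp only: fact_Suc mult.assoc)
qed simp

text \<open>The sum is the \<open>k\<close>th difference of \<open>x ^ m\<close> with step
  \<open>1\<close> at the point \<open>1\<close>, hence a value of the \<open>k\<close>th derivative
  of \<open>x ^ m\<close>.\<close>

lemma fdiff_coeff_moment: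
  assumes "m \<le> k" "k < n"
  shows "(\<Sum>i<n. fdiff_coeff k i * (1 + real i) ^ m) = (if m = k then fact k else 0)"
proof -
  have C: "C_k_on k UNIV (\<lambda>x. x ^ m)" for k
  proof (induction m)
    case (Suc m)
    then show ?case using C_k_on_mult[OF open_UNIV C_k_on_id] by simp
  qed simp
  obtain \<xi> where "(fdiff 1 ^^ k) (\<lambda>x. x ^ m) 1 = (deriv ^^ k) (\<lambda>x. x ^ m) \<xi>"
    using fdiff_mean_value[OF open_UNIV C, of 1 k 1] by auto
  also have "(deriv ^^ k) (\<lambda>x::real. x ^ m) = (deriv ^^ (k - m)) ((deriv ^^ m) (\<lambda>x. 1 * x ^ m))"
    using assms by (simp flip: funpow_add[THEN fun_cong, unfolded comp_def])
  also have "\<dots> \<xi> = (if m = k then fact k else 0)"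
    unfolding funpow_deriv_cmult_power funpow_deriv_const using assms by auto
  finally show ?thesis
    using fdiff_funpow_eq_sum[OF assms(2), of 1 "\<lambda>x. x ^ m" 1] by simp
qed

text \<open>The remainder coefficient is defined by solving the expansion for it, so only its limit
  needs proof. By Lagrange's form it is a value of the \<open>k\<close>th derivative between
  \<open>a\<close> and \<open>a + s\<close>.\<close>

lemma taylor_right:
  assumes I: "open I" "a \<in> I" and f: "C_k_on k I f"
  obtains \<phi> where "(\<phi> \<longlongrightarrow> (deriv ^^ k) f a) (at_right 0)"
    "\<And>s. s > 0 \<Longrightarrow> f (a + s) = (\<Sum>m<k. (deriv ^^ m) f a / fact m * s ^ m) + \<phi> s / fact k * s ^ k"
proof
  let ?\<phi> = "\<lambda>s. (f (a + s) - (\<Sum>m<k. (deriv ^^ m) f a / fact m * s ^ m)) / s ^ k * fact k"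
  show "(?\<phi> \<longlongrightarrow> (deriv ^^ k) f a) (at_right 0)"
  proof (rule tendsto_right_between[OF I, of _ 1])
    show "continuous_on I ((deriv ^^ k) f)" using f by (simp add: C_k_on_def)
  next
    fix s :: real assume s: "s > 0" "{a..a + 1 * s} \<subseteq> I"
    show "\<exists>\<xi>\<in>{a..a + 1 * s}. ?\<phi> s = (deriv ^^ k) f \<xi>"
    proof (cases "k = 0")
      case True
      then show ?thesis using s by (intro bexI[of _ "a + s"]) auto
    next
      case False
      have "\<forall>m t. m < k \<and> a \<le> t \<and> t \<le> a + s \<longrightarrow> DERIV ((deriv ^^ m) f) t :> (deriv ^^ Suc m) f t"
        using C_k_on_has_deriv[OF f] s by (auto simp: subset_iff)
      then obtain t where "a < t" "t < a + s"
        "f (a + s) = (\<Sum>m<k. (deriv ^^ m) f a / fact m * (a + s - a) ^ m) + (deriv ^^ k) f t / fact k * (a + s - a) ^ k"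
        using Taylor_up[of k "\<lambda>m. (deriv ^^ m) f" f a "a + s" a] False s by auto
      then show ?thesis using s by (intro bexI[of _ t]) auto
    qed
  qed simp
  fix s :: real assume "s > 0"
  then show "f (a + s) = (\<Sum>m<k. (deriv ^^ m) f a / fact m * s ^ m) + ?\<phi> s / fact k * s ^ k"
    by simp
qed

text \<open>The test matrices have entries \<open>a + e * (u i * u j)\<close>, and \<open>v\<close>
  is orthogonal to the powers \<open>u ^ m\<close> with \<open>m < k\<close>. All Taylor terms below
  order \<open>k\<close> drop out of the form at \<open>v\<close>; what remains, divided by
  \<open>e ^ k / k!\<close>, tends to \<open>(k!)^2\<close> times the \<open>k\<close>th
  derivative.\<close>

lemma deriv_nonneg_of_preserver:
  assumes I: "open I" "I \<subseteq> {0<..}" "a \<in> I" and f: "C_k_on k I f" and k: "k < n"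
    and pres: "\<And>A. psd_on {..<n} A \<Longrightarrow> (\<And>i j. i < n \<Longrightarrow> j < n \<Longrightarrow> A i j \<in> I) \<Longrightarrow> psd_on {..<n} (\<lambda>i j. f (A i j))"
  shows "0 \<le> (deriv ^^ k) f a"
proof -
  obtain \<phi> where \<phi>: "(\<phi> \<longlongrightarrow> (deriv ^^ k) f a) (at_right 0)"
    and tay: "\<And>s. s > 0 \<Longrightarrow> f (a + s) = (\<Sum>m<k. (deriv ^^ m) f a / fact m * s ^ m) + \<phi> s / fact k * s ^ k"
    using taylor_right[OF I(1,3) f] by blast
  \<comment> \<open>Positive entries keep the arguments to the right of \<open>a\<close>, as the
    one-sided expansion requires; the shift by \<open>1\<close> matches the moments of
    \<open>fdiff_coeff\<close>.\<close>
  define u where "u = (\<lambda>i. 1 + real i)"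
  have u: "u i > 0" for i by (simp add: u_def)
  define v where "v = fdiff_coeff k"
  have mom: "(\<Sum>i<n. v i * u i ^ m) = (if m = k then fact k else 0)" if "m \<le> k" for m
    using fdiff_coeff_moment[OF that k] by (simp add: u_def v_def)
  have momq: "quad_form {..<n} (\<lambda>i j. u i ^ m * u j ^ m) v = (if m = k then (fact k)\<^sup>2 else 0)" if "m \<le> k" for m
  proof -
    have "quad_form {..<n} (\<lambda>i j. u i ^ m * u j ^ m) v = (\<Sum>i<n. v i * u i ^ m)\<^sup>2"
      by (simp add: quad_form_def power2_eq_square sum_product mult_ac)
    then show ?thesis using mom[OF that] by simp
  qed
  let ?A = "\<lambda>e i j. a + e * (u i * u j)"
  have lim: "((\<lambda>e. \<phi> (e * (u i * u j))) \<longlongrightarrow> (deriv ^^ k) f a) (at_right 0)" for i j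
  proof -
    have "filterlim (\<lambda>e. e * (u i * u j)) (at_right 0) (at_right 0)"
      unfolding filterlim_at
    proof
      show "\<forall>\<^sub>F x in at_right 0. x * (u i * u j) \<in> {0<..} \<and> x * (u i * u j) \<noteq> 0"
        using eventually_at_right_less[of 0] by eventually_elim (use u[of i] u[of j] in auto)
      have "((\<lambda>e. e * (u i * u j)) \<longlongrightarrow> 0 * (u i * u j)) (at_right 0)" by (intro tendsto_intros)
      then show "((\<lambda>e. e * (u i * u j)) \<longlongrightarrow> 0) (at_right 0)" by simp
    qed
    then show ?thesis using filterlim_compose[OF \<phi>] by blast
  qed
  have "((\<lambda>e. quad_form {..<n} (\<lambda>i j. u i ^ k * u j ^ k * \<phi> (e * (u i * u j))) v) \<longlongrightarrow>
     quad_form {..<n} (\<lambda>i j. u i ^ k * u j ^ k * (deriv ^^ k) f a) v) (at_right 0)"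
    unfolding quad_form_def by (intro tendsto_intros lim)
  also have "quad_form {..<n} (\<lambda>i j. u i ^ k * u j ^ k * (deriv ^^ k) f a) v = (deriv ^^ k) f a * (fact k)\<^sup>2"
    using momq[of k] quad_form_cmult[of "{..<n}" "(deriv ^^ k) f a" "\<lambda>i j. u i ^ k * u j ^ k" v]
    by (simp add: mult.commute)
  finally have L: "((\<lambda>e. quad_form {..<n} (\<lambda>i j. u i ^ k * u j ^ k * \<phi> (e * (u i * u j))) v) \<longlongrightarrow>
     (deriv ^^ k) f a * (fact k)\<^sup>2) (at_right 0)" .
  have "\<forall>\<^sub>F e in at_right 0. 0 \<le> quad_form {..<n} (\<lambda>i j. u i ^ k * u j ^ k * \<phi> (e * (u i * u j))) v"
  proof -
    have "\<forall>\<^sub>F e in at_right 0. ?A e i j \<in> I" for i j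
    proof (rule topological_tendstoD[OF _ I(1)])
      have "((\<lambda>e. ?A e i j) \<longlongrightarrow> ?A 0 i j) (at_right 0)" by (intro tendsto_intros)
      then show "((\<lambda>e. ?A e i j) \<longlongrightarrow> a) (at_right 0)" by simp
    qed (use I in auto)
    then have "\<forall>\<^sub>F e in at_right 0. \<forall>i\<in>{..<n}. \<forall>j\<in>{..<n}. ?A e i j \<in> I"
      by (simp add: eventually_ball_finite_distrib)
    moreover have "\<forall>\<^sub>F e in at_right 0. (0::real) < e" by (simp add: eventually_at_right_less)
    ultimately show ?thesis
    proof eventually_elim
      case (elim e)
      \<comment> \<open>As \<open>a > 0\<close>, the constant matrix is of rank one, generated by
        the constant vector \<open>sqrt a\<close>.\<close>
      have "psd_on {..<n} (?A e)"
        using psd_on_add[OF psd_on_rank1[of _ "\<lambda>_. sqrt a"] psd_on_cmult[OF psd_on_rank1[of _ u]]] elim I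
        by (auto simp: real_sqrt_mult_self)
      then have "0 \<le> quad_form {..<n} (\<lambda>i j. f (?A e i j)) v"
        using pres[of "?A e"] elim psd_on_nonneg by blast
      also have "\<dots> = quad_form {..<n} (\<lambda>i j. (\<Sum>m<k. ((deriv ^^ m) f a / fact m * e ^ m) * (u i ^ m * u j ^ m))
          + (e ^ k / fact k) * (u i ^ k * u j ^ k * \<phi> (e * (u i * u j)))) v"
        using elim u by (intro quad_form_cong) (simp_all add: tay power_mult_distrib mult_ac)
      also have "\<dots> = quad_form {..<n} (\<lambda>i j. \<Sum>m<k. ((deriv ^^ m) f a / fact m * e ^ m) * (u i ^ m * u j ^ m)) v
          + (e ^ k / fact k) * quad_form {..<n} (\<lambda>i j. u i ^ k * u j ^ k * \<phi> (e * (u i * u j))) v"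
        by (simp only: quad_form_add quad_form_cmult)
      also have "quad_form {..<n} (\<lambda>i j. \<Sum>m<k. ((deriv ^^ m) f a / fact m * e ^ m) * (u i ^ m * u j ^ m)) v
          = (\<Sum>m<k. ((deriv ^^ m) f a / fact m * e ^ m) * quad_form {..<n} (\<lambda>i j. u i ^ m * u j ^ m) v)"
      proof -
        have "quad_form {..<n} (\<lambda>i j. \<Sum>m\<in>M. F m i j) v = (\<Sum>m\<in>M. quad_form {..<n} (F m) v)"
          if "finite M" for M :: "nat set" and F
          using that by (induction M) (simp_all add: quad_form_add quad_form_def[of _ "\<lambda>i j. 0"])
        then show ?thesis by (simp only: quad_form_cmult finite_lessThan)
      qed
      also have "\<dots> = 0" using momq by simp
      finally have "0 \<le> (e ^ k / fact k) * quad_form {..<n} (\<lambda>i j. u i ^ k * u j ^ k * \<phi> (e * (u i * u j))) v"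
        by simp
      moreover have "0 < e ^ k / fact k" using elim by simp
      ultimately show ?case by (meson mult_pos_neg not_le)
    qed
  qed
  then have "0 \<le> (deriv ^^ k) f a * (fact k)\<^sup>2"
    by (rule tendsto_lowerbound[OF L]) simp
  then show ?thesis by (simp add: zero_le_mult_iff)
qed

section \<open>The inductive step of FitzGerald and Horn\<close>

lemma psd_on_reindex:
  assumes "finite A" "finite S" "h ` A \<subseteq> S" "psd_on S G"
  shows "psd_on A (\<lambda>i j. G (h i) (h j))"
proof -
  have "psd_on (h ` A) G" by (rule psd_on_subset[OF assms(2-4)])
  then show ?thesis unfolding psd_on_def using quad_form_image[OF assms(1), of G h] by auto
qed

text \<open>A convex function lies above its tangent at \<open>0\<close>, and a tangent of negative
  slope is unbounded above towards minus infinity.\<close>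

lemma deriv_nonneg_of_bounded_convex:
  fixes \<phi> :: "real \<Rightarrow> real"
  assumes d1: "\<And>s. s \<le> 0 \<Longrightarrow> (\<phi> has_real_derivative \<phi>' s) (at s)"
    and d2: "\<And>s. s \<le> 0 \<Longrightarrow> (\<phi>' has_real_derivative \<phi>'' s) (at s)"
    and convex: "\<And>s. s \<le> 0 \<Longrightarrow> 0 \<le> \<phi>'' s"
    and bounded: "\<And>s. s \<le> 0 \<Longrightarrow> \<bar>\<phi> s\<bar> \<le> C"
  shows "0 \<le> \<phi>' 0"
proof (rule ccontr)
  assume "\<not> ?thesis"
  then have neg: "\<phi>' 0 < 0" by simp
  have C: "0 \<le> C" using bounded[of 0] by linarith
  \<comment> \<open>The tangent changes by \<open>- (2 * C + 1)\<close> from \<open>s\<close> to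
    \<open>0\<close>, more than two values bounded by \<open>C\<close> can differ.\<close>
  define s where "s = (2 * C + 1) / \<phi>' 0"
  have s: "s < 0" using neg C by (simp add: s_def divide_pos_neg)
  obtain z where z: "s < z" "z < 0" "\<phi> 0 - \<phi> s = (0 - s) * \<phi>' z"
    using MVT2[OF s, of \<phi> \<phi>'] d1 by auto
  have "\<phi>' z \<le> \<phi>' 0"
    by (rule DERIV_nonneg_imp_nondecreasing) (use z d2 convex in auto)
  then have "(0 - s) * \<phi>' z \<le> (0 - s) * \<phi>' 0" using s by (intro mult_left_mono) auto
  also have "\<dots> = - (2 * C + 1)" using neg by (simp add: s_def)
  finally show False using z bounded[of 0] bounded[of s] s by linarith
qed

text \<open>The vectors \<open>u i = exp (x / 2 + i * h)\<close> produce the kernel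
  \<open>f (exp (x + (i + j) * h))\<close> at equally spaced points, to which finite differences
  apply.\<close>

lemma hankel_psd_of_rank1_preserver:
  assumes I: "open I" "\<And>x. x \<in> I \<Longrightarrow> {0<..x} \<subseteq> I"
    and f: "C_k_on (2 * n - 2) I f"
    and rank1: "\<And>u. (\<And>i. i < n \<Longrightarrow> 0 < u i \<and> u i * u i \<in> I) \<Longrightarrow> psd_on {..<n} (\<lambda>i j. f (u i * u j))"
    and x: "exp x \<in> I"
  shows "psd_on {..<n} (\<lambda>i j. (deriv ^^ (i + j)) (\<lambda>t. f (exp t)) x)"
proof (rule hankel_psd_of_gram_psd[of "exp -` I"])
  show J: "open (exp -` I)" using I(1) by (intro open_vimage continuous_intros)
  show "C_k_on (2 * n - 2) (exp -` I) (\<lambda>t. f (exp t))"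
    by (rule C_k_on_compose[OF I(1) J f C_k_on_exp]) auto
  have "\<forall>\<^sub>F h in at_right 0. exp (x + 2 * real i * h) \<in> I" for i
  proof (rule topological_tendstoD[OF _ I(1)])
    have "((\<lambda>h. exp (x + 2 * real i * h)) \<longlongrightarrow> exp (x + 2 * real i * 0)) (at_right 0)"
      by (intro tendsto_intros)
    then show "((\<lambda>h. exp (x + 2 * real i * h)) \<longlongrightarrow> exp x) (at_right 0)" by simp
  qed (rule x)
  then have "\<forall>\<^sub>F h in at_right 0. \<forall>i\<in>{..<n}. exp (x + 2 * real i * h) \<in> I"
    by (simp add: eventually_ball_finite_distrib)
  then show "\<forall>\<^sub>F h in at_right 0. psd_on {..<n} (\<lambda>i j. f (exp (x + real (i + j) * h)))"
  proof eventually_elim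
    case (elim h)
    have "psd_on {..<n} (\<lambda>i j. f (exp (x / 2 + real i * h) * exp (x / 2 + real j * h)))"
      by (rule rank1) (use elim in \<open>auto simp: exp_add[symmetric] algebra_simps\<close>)
    then show ?case by (simp add: exp_add[symmetric] algebra_simps)
  qed
qed (use x in auto)

text \<open>The product is at most the larger square, and \<open>I\<close> is closed downwards. So
  for rank one matrices it suffices to control the diagonal entries.\<close>

lemma mult_mem_of_squares:
  fixes a b :: real
  assumes "\<And>x. x \<in> I \<Longrightarrow> {0<..x} \<subseteq> I" "0 < a" "a * a \<in> I" "0 < b" "b * b \<in> I"
  shows "a * b \<in> I"
proof (cases "a \<le> b")
  case True
  then show ?thesis using assms(1)[OF assms(5)] assms(2-) by (simp add: subset_iff mult_right_mono)
next
  case False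
  then show ?thesis using assms(1)[OF assms(3)] assms(2-) by (simp add: subset_iff mult_left_mono)
qed

text \<open>With \<open>g t = f (exp t)\<close>, the kernel \<open>g'' (s + t)\<close> is positive semidefinite because its Hankel
  matrices are submatrices of those of \<open>g\<close>. So \<open>s \<mapsto> \<Sum> v\<^sub>i v\<^sub>j g (s + t\<^sub>i + t\<^sub>j)\<close> is convex, and being
  bounded near \<open>-\<infinity>\<close> it is increasing.\<close>

lemma deriv_rank1_preserver:
  assumes I: "open I" "\<And>x. x \<in> I \<Longrightarrow> {0<..x} \<subseteq> I"
    and m: "m \<ge> 1" and f: "C_k_on (2 * m) I f"
    and f0: "\<And>x. x \<in> I \<Longrightarrow> 0 \<le> f x" and f1: "\<And>x. x \<in> I \<Longrightarrow> 0 \<le> deriv f x"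
    and rank1: "\<And>u. (\<And>i. i < Suc m \<Longrightarrow> 0 < u i \<and> u i * u i \<in> I) \<Longrightarrow> psd_on {..<Suc m} (\<lambda>i j. f (u i * u j))"
    and u: "\<And>i. i < m \<Longrightarrow> 0 < u i \<and> u i * u i \<in> I"
  shows "psd_on {..<m} (\<lambda>i j. deriv f (u i * u j))"
proof -
  define J where "J = exp -` I"
  have J: "open J" using I(1) unfolding J_def by (intro open_vimage continuous_intros)
  have down: "s \<in> J" if "t \<in> J" "s \<le> t" for s t
    using that I(2)[of "exp t"] by (auto simp: J_def)
  have Jint: "is_interval J" unfolding is_interval_1 using down by blast
  define g where "g = (\<lambda>t. f (exp t))"
  have gC: "C_k_on (2 * m) J g"
    unfolding g_def by (rule C_k_on_compose[OF I(1) J f C_k_on_exp]) (auto simp: J_def)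
  define g2 where "g2 = (deriv ^^ 2) g"
  have m2: "2 + (2 * m - 2) = 2 * m" using m by simp
  have g2C: "C_k_on (2 * m - 2) J g2"
    unfolding g2_def by (rule C_k_on_funpow_deriv) (simp only: m2 gC)
  have g2H: "psd_on {..<m} (\<lambda>i j. (deriv ^^ (i + j)) g2 x)" if "x \<in> J" for x
  proof -
    have "psd_on {..<Suc m} (\<lambda>i j. (deriv ^^ (i + j)) g x)"
      unfolding g_def
    proof (rule hankel_psd_of_rank1_preserver[OF I])
      show "psd_on {..<Suc m} (\<lambda>i j. f (u i * u j))" if "\<And>i. i < Suc m \<Longrightarrow> 0 < u i \<and> u i * u i \<in> I" for u
        using that by (rule rank1)
    qed (use f that J_def in auto)
    \<comment> \<open>Deleting the first row and column of the Hankel matrix of \<open>g\<close>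
      leaves that of \<open>g2\<close>.\<close>
    from psd_on_reindex[OF _ _ _ this, of "{..<m}" Suc]
    have "psd_on {..<m} (\<lambda>i j. (deriv ^^ (Suc i + Suc j)) g x)" by auto
    moreover have "(deriv ^^ (Suc i + Suc j)) g x = (deriv ^^ (i + j)) g2 x" for i j
    proof -
      have "Suc i + Suc j = (i + j) + 2" by simp
      then show ?thesis unfolding g2_def by (simp only: funpow_add comp_apply)
    qed
    ultimately show ?thesis by simp
  qed
  define t where "t = (\<lambda>i. ln (u i))"
  have et: "exp (t i + t j) = u i * u j" if "i < m" "j < m" for i j
    using u[OF that(1)] u[OF that(2)] by (simp add: t_def exp_add)
  have uI: "u i * u j \<in> I" if "i < m" "j < m" for i j
    using mult_mem_of_squares[OF I(2)] u that by blast
  have tJ: "s + (t i + t j) \<in> J" if "i < m" "j < m" "s \<le> 0" for i j s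
    by (rule down[of "t i + t j"]) (use that et uI in \<open>auto simp: J_def\<close>)
  have gd: "(g has_real_derivative deriv g s) (at s)" "(deriv g has_real_derivative g2 s) (at s)" if "s \<in> J" for s
    using C_k_on_has_deriv[OF gC _ that, of 0] C_k_on_has_deriv[OF gC _ that, of 1] m
    by (simp_all add: g2_def numeral_2_eq_2)
  have gd': "deriv g s = deriv f (exp s) * exp s" if "s \<in> J" for s
  proof (rule DERIV_imp_deriv)
    have "(f has_real_derivative deriv f (exp s)) (at (exp s))"
      using C_k_on_has_deriv[OF f, of 0 "exp s"] m that by (simp add: J_def)
    then show "(g has_real_derivative deriv f (exp s) * exp s) (at s)"
      unfolding g_def by (rule DERIV_chain2) simp
  qed
  have g_mono: "g s \<le> g r" if "s \<le> r" "r \<in> J" for s r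
  proof (rule DERIV_nonneg_imp_nondecreasing[OF that(1)])
    fix x assume "s \<le> x" "x \<le> r"
    then have x: "x \<in> J" using down that by blast
    then have "0 \<le> deriv g x" using gd'[OF x] f1 by (simp add: J_def)
    then show "\<exists>y. (g has_real_derivative y) (at x) \<and> 0 \<le> y" using gd(1)[OF x] by blast
  qed
  have "0 \<le> quad_form {..<m} (\<lambda>i j. deriv g (0 + (t i + t j))) v" for v
  proof (rule deriv_nonneg_of_bounded_convex)
    fix s :: real assume s: "s \<le> 0"
    show "((\<lambda>s. quad_form {..<m} (\<lambda>i j. g (s + (t i + t j))) v) has_real_derivative
        quad_form {..<m} (\<lambda>i j. deriv g (s + (t i + t j))) v) (at s)"
      unfolding quad_form_def
      by (intro DERIV_sum DERIV_cmult) (use gd(1) tJ s in \<open>auto simp: DERIV_shift[symmetric]\<close>)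
    show "((\<lambda>s. quad_form {..<m} (\<lambda>i j. deriv g (s + (t i + t j))) v) has_real_derivative
        quad_form {..<m} (\<lambda>i j. g2 (s + (t i + t j))) v) (at s)"
      unfolding quad_form_def
      by (intro DERIV_sum DERIV_cmult) (use gd(2) tJ s in \<open>auto simp: DERIV_shift[symmetric]\<close>)
    \<comment> \<open>The shift \<open>s\<close> is split evenly between the two arguments to obtain
      a translation kernel of \<open>g2\<close>.\<close>
    have "psd_on {..<m} (\<lambda>i j. g2 ((s / 2 + t i) + (s / 2 + t j)))"
      by (rule gram_psd[OF J Jint g2C g2H]) (use tJ[OF _ _ s] in \<open>auto simp: algebra_simps\<close>)
    then show "0 \<le> quad_form {..<m} (\<lambda>i j. g2 (s + (t i + t j))) v"
      using psd_on_nonneg by (force simp: algebra_simps)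
    have "\<bar>g (s + (t i + t j))\<bar> \<le> g (t i + t j)" if "i < m" "j < m" for i j
      using g_mono[of "s + (t i + t j)" "t i + t j"] s tJ[OF that, of 0] tJ[OF that s] f0
      by (auto simp: g_def J_def)
    then show "\<bar>quad_form {..<m} (\<lambda>i j. g (s + (t i + t j))) v\<bar> \<le>
        (\<Sum>i<m. \<Sum>j<m. \<bar>v i * v j\<bar> * g (t i + t j))"
      unfolding quad_form_def
      by (intro order_trans[OF sum_abs] sum_mono) (auto simp: abs_mult intro!: mult_left_mono)
  qed
  then have "psd_on {..<m} (\<lambda>i j. deriv g (t i + t j))"
    by (simp add: psd_on_def add.commute)
  \<comment> \<open>By the chain rule \<open>deriv g (t i + t j)\<close> carries the factor
    \<open>exp (t i + t j) = u i * u j\<close>, which this scaling removes.\<close>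
  then have P: "psd_on {..<m} (\<lambda>i j. inverse (u i) * inverse (u j) * deriv g (t i + t j))"
    by (rule psd_on_congruence)
  have "inverse (u i) * inverse (u j) * deriv g (t i + t j) = deriv f (u i * u j)"
    if "i < m" "j < m" for i j
    using gd'[of "t i + t j"] tJ[OF that, of 0] et[OF that] u[OF that(1)] u[OF that(2)]
    by (simp add: field_simps)
  then show ?thesis
    by (intro psd_on_cong[THEN iffD1, OF _ P]) simp
qed

text \<open>Along the segment, the derivative of the form belongs to an entrywise product:
  \<open>deriv f\<close> applied to a point of the segment, times a semidefinite matrix with zero
  last row and column. Only a block of one dimension less matters, where the induction hypothesis
  for \<open>deriv f\<close> and Schur's product theorem apply.\<close>

lemma preserver_of_rank1_preserver:
  assumes I: "open I" "I \<subseteq> {0<..}" "\<And>x. x \<in> I \<Longrightarrow> {0<..x} \<subseteq> I"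
    and f: "C_k_on (2 * m) I f"
    and nonneg: "\<And>x k. x \<in> I \<Longrightarrow> k \<le> m \<Longrightarrow> 0 \<le> (deriv ^^ k) f x"
    and rank1: "\<And>u. (\<And>i. i < Suc m \<Longrightarrow> 0 < u i \<and> u i * u i \<in> I) \<Longrightarrow> psd_on {..<Suc m} (\<lambda>i j. f (u i * u j))"
    and A: "psd_on {..<Suc m} A" "\<And>i j. i < Suc m \<Longrightarrow> j < Suc m \<Longrightarrow> A i j \<in> I"
  shows "psd_on {..<Suc m} (\<lambda>i j. f (A i j))"
  using f nonneg rank1 A
proof (induction m arbitrary: f A)
  case 0
  have "0 \<le> f (A 0 0)" using 0(2)[of "A 0 0" 0] 0(5)[of 0 0] by simp
  then show ?case by (simp add: psd_on_def quad_form_def)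
next
  case (Suc m)
  note f = Suc.prems(1) and nonneg = Suc.prems(2) and rank1 = Suc.prems(3) and A = Suc.prems(4) and AI = Suc.prems(5)
  \<comment> \<open>\<open>p\<close> is at once the dimension in which \<open>deriv f\<close> is
    handled and the index of the last row of \<open>A\<close>, whose dimension is
    \<open>Suc p\<close>.\<close>
  define p where "p = Suc m"
  have IHf: "psd_on {..<p} (\<lambda>i j. deriv f (X i j))"
    if X: "psd_on {..<p} X" "\<And>i j. i < p \<Longrightarrow> j < p \<Longrightarrow> X i j \<in> I" for X
    unfolding p_def
  proof (rule Suc.IH[where f = "deriv f" and A = X])
    show "C_k_on (2 * m) I (deriv f)"
      using C_k_on_funpow_deriv[of 1 "2 * m" I f] C_k_on_mono[OF f, of "1 + 2 * m"] by simp
    show "0 \<le> (deriv ^^ k) (deriv f) x" if "x \<in> I" "k \<le> m" for x k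
      using nonneg[of x "Suc k"] that by (simp add: funpow_Suc_right del: funpow.simps)
    show "psd_on {..<Suc m} (\<lambda>i j. deriv f (u i * u j))" if "\<And>i. i < Suc m \<Longrightarrow> 0 < u i \<and> u i * u i \<in> I" for u
      by (rule deriv_rank1_preserver[OF I(1,3) _ f _ _ rank1 that])
        (use nonneg[of _ 0] nonneg[of _ 1] in auto)
  qed (use X p_def in auto)
  let ?S = "{..<Suc p}"
  have AS: "psd_on ?S A" and AI: "\<And>i j. i \<in> ?S \<Longrightarrow> j \<in> ?S \<Longrightarrow> A i j \<in> I" using A AI by (auto simp: p_def)
  have Apos: "A i j > 0" if "i \<in> ?S" "j \<in> ?S" for i j using AI[OF that] I(2) by auto
  have pp: "A p p > 0" by (rule Apos) auto
  \<comment> \<open>The last column of \<open>A\<close>, scaled so that the matrix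
    \<open>z i * z j\<close> agrees with \<open>A\<close> in its last row and column.\<close>
  define z where "z = (\<lambda>i. A i p / sqrt (A p p))"
  have zpos: "z i > 0" if "i \<in> ?S" for i using Apos[OF that, of p] pp by (simp add: z_def)
  define L where "L = (\<lambda>i j. A i j - A i p * A j p / A p p)"
  have Lz: "A i j = z i * z j + L i j" for i j
    using pp by (simp add: z_def L_def field_simps flip: power2_eq_square)
  have L: "psd_on ?S L" unfolding L_def by (rule psd_on_schur_complement[OF _ AS]) (use pp in auto)
  \<comment> \<open>The diagonal of the Schur complement \<open>L\<close> is nonnegative, so
    \<open>z i * z i\<close> is at most \<open>A i i\<close>.\<close>
  have zz: "z i * z i \<in> I" if "i \<in> ?S" for i
    by (rule subsetD[OF I(3)[OF AI[OF that that]]]) (use zpos[OF that] Lz[of i i] psd_on_diag(2)[OF _ L that] in auto)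
  have zI: "z i * z j \<in> I" if "i \<in> ?S" "j \<in> ?S" for i j
    using mult_mem_of_squares[OF I(3)] zpos zz that by blast
  have Lp: "L p i = 0" "L i p = 0" if "i \<in> ?S" for i
    using pp psd_on_sym[OF AS that, of p] by (auto simp: L_def)
  define X where "X = (\<lambda>l i j. z i * z j + l * L i j)"
  have XI: "X l i j \<in> I" if "i \<in> ?S" "j \<in> ?S" "0 \<le> l" "l \<le> 1" for l i j
  proof -
    have eq: "X l i j = (1 - l) * (z i * z j) + l * A i j" by (simp add: X_def Lz algebra_simps)
    have pos: "0 < X l i j"
    proof (cases "l = 1")
      case False
      then have "0 < (1 - l) * (z i * z j)" using that zpos by simp
      then show ?thesis unfolding eq using that Apos[OF that(1,2)] by (simp add: add_pos_nonneg)
    qed (use eq Apos[OF that(1,2)] in simp)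
    have "X l i j \<le> max (z i * z j) (A i j)"
      unfolding eq by (rule convex_bound_le) (use that in auto)
    then have "X l i j \<in> {0<..max (z i * z j) (A i j)}" using pos by simp
    moreover have "max (z i * z j) (A i j) \<in> I" using zI[OF that(1,2)] AI[OF that(1,2)] by (simp add: max_def)
    ultimately show ?thesis using I(3) by blast
  qed
  have XS: "psd_on ?S (X l)" if "0 \<le> l" for l
    unfolding X_def by (intro psd_on_add psd_on_rank1 psd_on_cmult L that)
  have "0 \<le> quad_form ?S (\<lambda>i j. f (A i j)) v" for v
  proof -
    define \<phi> where "\<phi> = (\<lambda>l. quad_form ?S (\<lambda>i j. f (X l i j)) v)"
    have "\<phi> 0 \<le> \<phi> 1"
    proof (rule DERIV_nonneg_imp_nondecreasing[of 0 1 \<phi>])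
      fix l :: real assume l: "0 \<le> l" "l \<le> 1"
      have "((\<lambda>l. f (X l i j)) has_real_derivative deriv f (X l i j) * L i j) (at l)"
        if "i \<in> ?S" "j \<in> ?S" for i j
      proof (rule DERIV_chain2[of f])
        show "(f has_real_derivative deriv f (X l i j)) (at (X l i j))"
          using C_k_on_has_deriv[OF f, of 0] XI[OF that l] by simp
        show "((\<lambda>l. X l i j) has_real_derivative L i j) (at l)"
          unfolding X_def by (auto intro!: derivative_eq_intros)
      qed
      then have "(\<phi> has_real_derivative quad_form ?S (\<lambda>i j. deriv f (X l i j) * L i j) v) (at l)"
        unfolding \<phi>_def quad_form_def by (intro DERIV_sum DERIV_cmult)
      moreover have "quad_form ?S (\<lambda>i j. deriv f (X l i j) * L i j) v
          = quad_form {..<p} (\<lambda>i j. deriv f (X l i j) * L i j) v"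
        using Lp by (simp add: quad_form_def)
      moreover have "0 \<le> quad_form {..<p} (\<lambda>i j. deriv f (X l i j) * L i j) v"
      proof (rule psd_on_hadamard_nonneg)
        show "psd_on {..<p} (\<lambda>i j. deriv f (X l i j))"
          by (rule IHf[OF psd_on_subset[OF _ _ XS[OF l(1)]]]) (use XI l in auto)
        show "psd_on {..<p} L" by (rule psd_on_subset[OF _ _ L]) auto
      qed simp
      ultimately show "\<exists>y. (\<phi> has_real_derivative y) (at l) \<and> 0 \<le> y" by metis
    qed simp
    moreover have "0 \<le> \<phi> 0"
      unfolding \<phi>_def X_def
      by (simp del: sum.lessThan_Suc) (rule psd_on_nonneg, unfold p_def, rule rank1, use zpos zz p_def in auto)
    moreover have "\<phi> 1 = quad_form ?S (\<lambda>i j. f (A i j)) v"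
      by (simp add: \<phi>_def X_def Lz)
    ultimately show ?thesis by simp
  qed
  then have "psd_on ?S (\<lambda>i j. f (A i j))"
    using psd_on_sym[OF AS] by (auto simp: psd_on_def)
  then show ?case by (simp add: p_def)
qed

section \<open>Matrices and the main theorem\<close>

lemma pos_semidef_iff:
  "pos_semidef n A \<longleftrightarrow> A \<in> carrier_mat n n \<and> psd_on {..<n} (\<lambda>i j. A $$ (i, j))"
proof (cases "A \<in> carrier_mat n n")
  case A: True
  have q: "scalar_prod v (A *\<^sub>v v) = quad_form {..<n} (\<lambda>i j. A $$ (i, j)) (\<lambda>i. v $ i)"
    if "v \<in> carrier_vec n" for v
    using A that
    by (simp add: quad_form_def scalar_prod_def sum_distrib_left mult_ac atLeast0LessThan)
  have "transpose_mat A = A \<longleftrightarrow> (\<forall>i\<in>{..<n}. \<forall>j\<in>{..<n}. A $$ (i, j) = A $$ (j, i))"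
    using A by (auto simp: mat_eq_iff)
  moreover have "(\<forall>v \<in> carrier_vec n. 0 \<le> scalar_prod v (A *\<^sub>v v)) \<longleftrightarrow>
      (\<forall>w. 0 \<le> quad_form {..<n} (\<lambda>i j. A $$ (i, j)) w)"
  proof
    assume H: "\<forall>v \<in> carrier_vec n. 0 \<le> scalar_prod v (A *\<^sub>v v)"
    show "\<forall>w. 0 \<le> quad_form {..<n} (\<lambda>i j. A $$ (i, j)) w"
    proof
      fix w
      have "quad_form {..<n} (\<lambda>i j. A $$ (i, j)) w = quad_form {..<n} (\<lambda>i j. A $$ (i, j)) (\<lambda>i. vec n w $ i)"
        by (rule quad_form_cong) auto
      then show "0 \<le> quad_form {..<n} (\<lambda>i j. A $$ (i, j)) w"
        using bspec[OF H vec_carrier, of w] q[OF vec_carrier, of w] by simp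
    qed
  qed (simp add: q)
  ultimately show ?thesis using A by (simp add: pos_semidef_def psd_on_def)
qed (simp add: pos_semidef_def)

lemma elements_mat_subset_iff:
  assumes "A \<in> carrier_mat n n"
  shows "elements_mat A \<subseteq> I \<longleftrightarrow> (\<forall>i<n. \<forall>j<n. A $$ (i, j) \<in> I)"
  using assms by (force intro: elements_matI dest: elements_matD)

text \<open>All columns are nonzero multiples of the first one, which alone is therefore a maximal
  independent subset of the set of columns.\<close>

lemma rank_rank1_mat:
  fixes u :: "nat \<Rightarrow> real"
  assumes n: "n \<ge> 1" and u: "\<And>i. i < n \<Longrightarrow> u i > 0"
  shows "vec_space.rank n (mat n n (\<lambda>(i, j). u i * u j)) = 1"
proof -
  interpret vec_space "TYPE(real)" n .
  define A where "A = mat n n (\<lambda>(i, j). u i * u j)"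
  have A: "A \<in> carrier_mat n n" by (simp add: A_def)
  have cA: "set (cols A) \<subseteq> carrier_vec n" using A cols_dim by blast
  have colA: "\<exists>j<n. x = vec n (\<lambda>i. u i * u j)" if "x \<in> set (cols A)" for x
    using that by (auto simp: cols_def A_def)
  define a where "a = col A 0"
  have a: "a \<in> set (cols A)" using n A by (simp add: a_def cols_def)
  have "a $ 0 \<noteq> 0" using n u[of 0] by (simp add: a_def A_def)
  have "lin_indpt {a}"
  proof
    assume "lin_dep {a}"
    then obtain c where c: "lincomb c {a} = 0\<^sub>v n" "c a \<noteq> 0"
      unfolding lin_dep_def by (auto simp: subset_singleton_iff)
    have "lincomb c {a} $ 0 = c a * a $ 0"
      using lincomb_index[of 0 "{a}" c] n a cA by auto
    then show False using c \<open>a $ 0 \<noteq> 0\<close> n by simp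
  qed
  moreover have "T = {a}" if T: "{a} \<subseteq> T" "T \<subseteq> set (cols A)" "lin_indpt T" for T
  proof (rule ccontr)
    assume "T \<noteq> {a}"
    then obtain b where b: "b \<in> T" "b \<noteq> a" using T by blast
    obtain j where j: "j < n" "b = vec n (\<lambda>i. u i * u j)" using colA b T by blast
    have av: "a = vec n (\<lambda>i. u i * u 0)" using n by (auto simp: a_def A_def)
    \<comment> \<open>From \<open>a = u 0 * u\<close> and \<open>b = u j * u\<close> comes the
      relation \<open>u j * a - u 0 * b = 0\<close>.\<close>
    define c where "c = (\<lambda>x. if x = a then u j else - u 0)"
    have carr: "a \<in> carrier_vec n" "b \<in> carrier_vec n" using j av by auto
    have "lincomb c {a, b} $ i = 0" if "i < n" for i
    proof -
      have "lincomb c {a, b} $ i = c a * a $ i + c b * b $ i"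
        using lincomb_index[OF that, of "{a, b}" c] carr b(2) by simp
      also have "\<dots> = 0" using b(2) that by (simp add: c_def) (simp add: j(2) av)
      finally show ?thesis .
    qed
    then have "lincomb c {a, b} = 0\<^sub>v n"
      using lincomb_dim[of "{a, b}" c] carr by (intro eq_vecI) auto
    then have "lin_dep T"
      unfolding lin_dep_def using T b u[OF j(1)]
      by (intro exI[of _ "{a, b}"] exI[of _ c] exI[of _ a]) (auto simp: c_def)
    then show False using T by simp
  qed
  ultimately have "maximal {a} (\<lambda>T. T \<subseteq> set (cols A) \<and> lin_indpt T)"
    using a by (auto simp: maximal_def)
  then have "rank A = 1" using rank_card_indpt[OF A] by fastforce
  then show ?thesis by (simp add: A_def)
qed

section \<open>Euler derivatives in exponential coordinates\<close>

lemma C_k_on_euler: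
  assumes "open S" "C_k_on (Suc k) S f"
  shows "C_k_on k S (euler f)"
  unfolding euler_def by (rule C_k_on_mult[OF assms(1) C_k_on_id]) (use assms(2) C_k_on_Suc in blast)

text \<open>Under \<open>x = exp t\<close> the operator \<open>x d/dx\<close> becomes
  \<open>d/dt\<close>. The innermost operator is split off, and the induction hypothesis is applied
  to \<open>euler f\<close>, which loses one order of smoothness.\<close>

lemma funpow_euler_exp:
  assumes I: "open I" and f: "C_k_on m I f" and t: "exp t \<in> I" and k: "k \<le> m"
  shows "(euler ^^ k) f (exp t) = (deriv ^^ k) (\<lambda>t. f (exp t)) t"
  using f k t
proof (induction k arbitrary: f m t)
  case 0
  then show ?case by simp
next
  case (Suc k)
  obtain m' where m': "m = Suc m'" using Suc.prems by (cases m) auto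
  have J: "open (exp -` I)" using I by (intro open_vimage continuous_intros)
  have "(euler ^^ Suc k) f (exp t) = (euler ^^ k) (euler f) (exp t)"
    by (simp add: funpow_Suc_right del: funpow.simps)
  also have "\<dots> = (deriv ^^ k) (\<lambda>t. euler f (exp t)) t"
    by (rule Suc.IH[of m']) (use C_k_on_euler[OF I] Suc.prems m' in auto)
  also have "\<dots> = (deriv ^^ k) (deriv (\<lambda>t. f (exp t))) t"
  proof (rule funpow_deriv_cong_on[OF J])
    fix s assume s: "s \<in> exp -` I"
    have "(f has_real_derivative deriv f (exp s)) (at (exp s))"
      using C_k_on_has_deriv[OF Suc.prems(1), of 0 "exp s"] m' s by simp
    then have "((\<lambda>t. f (exp t)) has_real_derivative deriv f (exp s) * exp s) (at s)"
      by (rule DERIV_chain2) simp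
    then show "euler f (exp s) = deriv (\<lambda>t. f (exp t)) s"
      using DERIV_imp_deriv by (fastforce simp: euler_def)
  qed (use Suc.prems in simp)
  also have "\<dots> = (deriv ^^ Suc k) (\<lambda>t. f (exp t)) t"
    by (simp add: funpow_Suc_right del: funpow.simps)
  finally show ?case .
qed

theorem theorem1p1:
  fixes n :: nat and \<rho> :: ereal and I :: "real set" and f :: "real \<Rightarrow> real"
  assumes n: "n \<ge> 1"
    and \<rho>: "0 < \<rho>"
    and I: "I = {x. 0 < x \<and> ereal x < \<rho>}"
    and f: "C_k_on (2 * n - 2) I f"
  shows
    "let i = (\<forall>A \<in> psd_mats n I. pos_semidef n (map_mat f A));
         ii = ((\<forall>R \<in> psd_mats_rank1 n I. pos_semidef n (map_mat f R)) \<and>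
               (\<forall>x \<in> I. \<forall>k \<le> n - 1. (deriv ^^ k) f x \<ge> 0));
         iii = ((\<forall>x \<in> I. \<forall>k \<le> n - 1. (deriv ^^ k) f x \<ge> 0) \<and>
                (\<forall>x \<in> I. pos_semidef n (euler_hankel n f x)))
     in (i \<longleftrightarrow> ii) \<and> (ii \<longleftrightarrow> iii)"
proof -
  have Ipos: "I \<subseteq> {0<..}" using I by auto
  have Idown: "{0<..x} \<subseteq> I" if "x \<in> I" for x
    using that le_less_trans[of "ereal _" "ereal x" \<rho>] by (auto simp: I)
  have Iopen: "open I"
  proof -
    have "I = {0<..} \<inter> ereal -` {..<\<rho>}" by (auto simp: I)
    moreover have "open (ereal -` {..<\<rho>})"
      by (intro open_vimage open_lessThan continuous_on_ereal continuous_on_id)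
    ultimately show ?thesis by auto
  qed
  define J where "J = exp -` I"
  have J: "open J" unfolding J_def using Iopen by (intro open_vimage continuous_intros)
  have Jdown: "s \<in> J" if "t \<in> J" "s \<le> t" for s t
    using that Idown[of "exp t"] by (auto simp: J_def)
  have Jint: "is_interval J" unfolding is_interval_1 using Jdown by blast
  obtain m where m: "n = Suc m" using n by (cases n) auto
  define D where "D \<longleftrightarrow> (\<forall>x \<in> I. \<forall>k \<le> n - 1. (deriv ^^ k) f x \<ge> 0)"
  \<comment> \<open>Rank one matrices enter here through generating vectors with positive entries;
    once the squares lie in \<open>I\<close>, so do all products.\<close>
  define R where "R \<longleftrightarrow> (\<forall>u. (\<forall>i<n. 0 < u i \<and> u i * u i \<in> I) \<longrightarrow> psd_on {..<n} (\<lambda>i j. f (u i * u j)))"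
  let ?i = "\<forall>A \<in> psd_mats n I. pos_semidef n (map_mat f A)"
  let ?ii = "\<forall>R \<in> psd_mats_rank1 n I. pos_semidef n (map_mat f R)"
  let ?iii = "\<forall>x \<in> I. pos_semidef n (euler_hankel n f x)"
  have i_iff: "?i \<longleftrightarrow> (\<forall>A. psd_on {..<n} A \<longrightarrow> (\<forall>i<n. \<forall>j<n. A i j \<in> I) \<longrightarrow> psd_on {..<n} (\<lambda>i j. f (A i j)))"
    (is "_ \<longleftrightarrow> ?i'")
  proof
    assume L: ?i
    show ?i'
    proof (intro allI impI)
      fix A assume A: "psd_on {..<n} A" "\<forall>i<n. \<forall>j<n. A i j \<in> I"
      define M where "M = mat n n (\<lambda>(i, j). A i j)"
      have M: "M \<in> carrier_mat n n" "\<And>i j. i < n \<Longrightarrow> j < n \<Longrightarrow> M $$ (i, j) = A i j" by (auto simp: M_def)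
      have "psd_on {..<n} (\<lambda>i j. M $$ (i, j))"
        by (rule psd_on_cong[THEN iffD2, OF _ A(1)]) (use M in auto)
      then have "M \<in> psd_mats n I"
        using M A(2) by (simp add: psd_mats_def pos_semidef_iff elements_mat_subset_iff)
      then have "psd_on {..<n} (\<lambda>i j. map_mat f M $$ (i, j))" using L pos_semidef_iff by blast
      then show "psd_on {..<n} (\<lambda>i j. f (A i j))"
        by (rule psd_on_cong[THEN iffD1, rotated]) (use M in auto)
    qed
  next
    assume L: ?i'
    show ?i
    proof
      fix M assume M: "M \<in> psd_mats n I"
      then have M: "M \<in> carrier_mat n n" "psd_on {..<n} (\<lambda>i j. M $$ (i, j))" "\<forall>i<n. \<forall>j<n. M $$ (i, j) \<in> I"
        by (auto simp: psd_mats_def pos_semidef_iff elements_mat_subset_iff)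
      then have "psd_on {..<n} (\<lambda>i j. f (M $$ (i, j)))" using L by blast
      then have "psd_on {..<n} (\<lambda>i j. map_mat f M $$ (i, j))"
        by (rule psd_on_cong[THEN iffD1, rotated]) (use M in auto)
      then show "pos_semidef n (map_mat f M)" using M by (simp add: pos_semidef_iff)
    qed
  qed
  have i_ii: "?i \<Longrightarrow> ?ii" by (auto simp: psd_mats_rank1_def)
  have ii_R: R if L: ?ii
    unfolding R_def
  proof (intro allI impI)
    fix u assume u: "\<forall>i<n. 0 < u i \<and> u i * u i \<in> I"
    define M where "M = mat n n (\<lambda>(i, j). u i * u j)"
    have M: "M \<in> carrier_mat n n" "\<And>i j. i < n \<Longrightarrow> j < n \<Longrightarrow> M $$ (i, j) = u i * u j" by (auto simp: M_def)
    have "psd_on {..<n} (\<lambda>i j. M $$ (i, j))"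
      by (rule psd_on_cong[THEN iffD2, OF _ psd_on_rank1[of _ u]]) (use M in auto)
    moreover have "\<forall>i<n. \<forall>j<n. M $$ (i, j) \<in> I"
    proof (intro allI impI)
      fix i j assume ij: "i < n" "j < n"
      show "M $$ (i, j) \<in> I"
        unfolding M(2)[OF ij] by (rule mult_mem_of_squares[OF Idown]) (use u ij in auto)
    qed
    moreover have "vec_space.rank n M = 1" unfolding M_def by (rule rank_rank1_mat[OF n]) (use u in auto)
    ultimately have "M \<in> psd_mats_rank1 n I"
      using M by (simp add: psd_mats_rank1_def psd_mats_def pos_semidef_iff elements_mat_subset_iff)
    then have "psd_on {..<n} (\<lambda>i j. map_mat f M $$ (i, j))" using L pos_semidef_iff by blast
    then show "psd_on {..<n} (\<lambda>i j. f (u i * u j))"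
      by (rule psd_on_cong[THEN iffD1, rotated]) (use M in auto)
  qed
  have hankel: "(deriv ^^ (i + j)) (\<lambda>t. f (exp t)) (ln x) = euler_hankel n f x $$ (i, j)"
    if "x \<in> I" "i < n" "j < n" for x i j
    using funpow_euler_exp[OF Iopen f, of "ln x" "i + j"] that Ipos by (auto simp: euler_hankel_def)
  have iii_iff: "?iii \<longleftrightarrow> (\<forall>x\<in>J. psd_on {..<n} (\<lambda>i j. (deriv ^^ (i + j)) (\<lambda>t. f (exp t)) x))"
  proof -
    have "pos_semidef n (euler_hankel n f x) \<longleftrightarrow> psd_on {..<n} (\<lambda>i j. (deriv ^^ (i + j)) (\<lambda>t. f (exp t)) (ln x))"
      if "x \<in> I" for x
    proof -
      have "euler_hankel n f x \<in> carrier_mat n n" by (simp add: euler_hankel_def)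
      moreover have "psd_on {..<n} (\<lambda>i j. euler_hankel n f x $$ (i, j)) \<longleftrightarrow>
          psd_on {..<n} (\<lambda>i j. (deriv ^^ (i + j)) (\<lambda>t. f (exp t)) (ln x))"
        by (rule psd_on_cong) (simp add: hankel[OF that])
      ultimately show ?thesis by (simp only: pos_semidef_iff simp_thms)
    qed
    moreover have "J = ln ` I"
    proof -
      have "exp (ln x) = x" if "x \<in> I" for x using that Ipos by auto
      then show ?thesis by (force simp: J_def image_iff)
    qed
    ultimately show ?thesis by simp
  qed
  have R_iii: ?iii if R
    unfolding iii_iff
    by (intro ballI hankel_psd_of_rank1_preserver[OF Iopen Idown f]) (use that in \<open>auto simp: R_def J_def\<close>)
  have iii_R: R if ?iii
    unfolding R_def
  proof (intro allI impI)
    fix u assume u: "\<forall>i<n. 0 < u i \<and> u i * u i \<in> I"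
    have uu: "exp (ln (u i) + ln (u j)) = u i * u j" if "i < n" "j < n" for i j
      using u that by (simp add: exp_add)
    have "psd_on {..<n} (\<lambda>i j. f (exp (ln (u i) + ln (u j))))"
    proof (rule gram_psd[OF J Jint, of n "\<lambda>t. f (exp t)"])
      show "C_k_on (2 * n - 2) J (\<lambda>t. f (exp t))"
        by (rule C_k_on_compose[OF Iopen J f C_k_on_exp]) (auto simp: J_def)
      show "ln (u i) + ln (u j) \<in> J" if "i < n" "j < n" for i j
        unfolding J_def vimage_eq uu[OF that]
        by (rule mult_mem_of_squares[OF Idown]) (use u that in auto)
    qed (use that iii_iff in blast)
    then show "psd_on {..<n} (\<lambda>i j. f (u i * u j))"
      by (rule psd_on_cong[THEN iffD1, rotated]) (use uu in auto)
  qed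
  have R_i: ?i if R D
    unfolding i_iff
  proof (intro allI impI)
    fix A assume "psd_on {..<n} A" "\<forall>i<n. \<forall>j<n. A i j \<in> I"
    then show "psd_on {..<n} (\<lambda>i j. f (A i j))"
      using preserver_of_rank1_preserver[OF Iopen Ipos Idown, of m f A] f that
      by (simp add: R_def D_def m)
  qed
  have i_D: D if ?i
    unfolding D_def
  proof (intro ballI allI impI)
    fix x k assume x: "x \<in> I" and k: "k \<le> n - 1"
    show "0 \<le> (deriv ^^ k) f x"
      by (rule deriv_nonneg_of_preserver[OF Iopen Ipos x C_k_on_mono[OF f], of k n])
        (use k n that i_iff in auto)
  qed
  \<comment> \<open>The cycle runs from (i) to (ii) and \<open>D\<close>, on to \<open>R\<close> and
    \<open>D\<close>, and back to (i). Condition (iii) is linked through \<open>R\<close>, whose way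
    back to (ii) leads through (i).\<close>
  have "?i \<longleftrightarrow> ?ii \<and> D" using i_ii i_D ii_R R_i by blast
  moreover have "?ii \<and> D \<longleftrightarrow> D \<and> ?iii" using i_ii ii_R R_i R_iii iii_R by blast
  ultimately show ?thesis unfolding Let_def D_def by blast
qed

end
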